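(* Let $k\ge 2$ be a constant integer and let $f(n)=o(\log\log n)$ be an arbitrary function with $f(n)\to\infty$. Let $G(n)$ be a random $k$-tree on $n+k$ vertices, and suppose that initially one vertex of $G(n)$ knows the rumor. Then, with probability $1-o(1)$ as $n\to\infty$, the Push-Pull protocol needs at least $n^{(k-1)/(k^2+k-1)}f(n)^{-2}$ rounds to inform all vertices of $G(n)$.
   Context: Random $k$-tree process: $G(0)$ is a clique on $k$ vertices; for $t=1,2,\dots,n$, $G(t)$ is obtained from $G(t-1)$ by choosing a $k$-clique of $G(t-1)$ uniformly at random, creating a new vertex, and joining it to all $k$ vertices of the chosen clique. $G(n)$ is called a random $k$-tree on $n+k$ vertices. Push-Pull protocol on a graph: in synchronous rounds, every informed vertex contacts a uniformly random neighbor and sends it the rumor, and every uninformed vertex contacts a uniformly random neighbor and receives the rumor if that neighbor knows it; all random choices are independent, and a vertex informed in a round cannot forward the rumor in that same round. *)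

theory Defs
  imports "HOL-Probability.Probability" "HOL-Library.Landau_Symbols"
begin

text \<open>Graphs on vertex set {..<m} are given by their edge set, a set of 2-element sets.\<close>

definition k_cliques :: "nat \<Rightarrow> nat set \<Rightarrow> nat set set \<Rightarrow> nat set set" where
  "k_cliques k V E = {C. C \<subseteq> V \<and> card C = k \<and> (\<forall>u\<in>C. \<forall>v\<in>C. u \<noteq> v \<longrightarrow> {u, v} \<in> E)}"

definition clique_edges :: "nat \<Rightarrow> nat set set" where
  "clique_edges k = {{u, v} | u v. u < k \<and> v < k \<and> u \<noteq> v}"

fun random_ktree :: "nat \<Rightarrow> nat \<Rightarrow> nat set set pmf" where
  "random_ktree k 0 = return_pmf (clique_edges k)"
| "random_ktree k (Suc n) =
     bind_pmf (random_ktree k n) (\<lambda>E.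
       map_pmf (\<lambda>C. E \<union> {{k + n, c} | c. c \<in> C})
               (pmf_of_set (k_cliques k {..<k + n} E)))"

definition nbrs :: "nat set set \<Rightarrow> nat \<Rightarrow> nat set" where
  "nbrs E v = {u. {u, v} \<in> E}"

definition pp_round :: "nat set \<Rightarrow> nat set set \<Rightarrow> nat set \<Rightarrow> nat set pmf" where
  "pp_round V E I =
     map_pmf (\<lambda>c. I \<union> {v \<in> V. c v \<in> I} \<union> c ` I)
             (Pi_pmf V undefined (\<lambda>v. pmf_of_set (nbrs E v)))"

fun pp_trace :: "nat set \<Rightarrow> nat set set \<Rightarrow> nat \<Rightarrow> nat \<Rightarrow> nat set list pmf" where
  "pp_trace V E s 0 = return_pmf [{s}]"
| "pp_trace V E s (Suc m) =
     bind_pmf (pp_trace V E s m) (\<lambda>tr. map_pmf (\<lambda>I. tr @ [I]) (pp_round V E (last tr)))"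

definition pp_experiment ::
  "nat \<Rightarrow> nat \<Rightarrow> (nat set set \<Rightarrow> nat) \<Rightarrow> nat \<Rightarrow> (nat set set \<times> nat set list) pmf" where
  "pp_experiment k n s m =
     bind_pmf (random_ktree k n) (\<lambda>E.
       map_pmf (\<lambda>tr. (E, tr)) (pp_trace {..<n + k} E (s E) m))"

definition needs_at_least :: "nat set \<Rightarrow> real \<Rightarrow> nat set list \<Rightarrow> bool" where
  "needs_at_least V T tr = (\<forall>t < length tr. real t < T \<longrightarrow> tr ! t \<noteq> V)"

end

theory Submission
  imports Defs "HOL-Real_Asymp.Real_Asymp"
begin

text \<open>
  Number the \<open>k\<close>-cliques in order of creation: the \<open>t\<close>-th step (\<open>t \<ge> 0\<close>) picks an index \<open>i t \<le> k * t\<close>,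
  creates the vertex \<open>k + t\<close> and the cliques \<open>k * t + 1, \<dots>, k * t + k\<close>, so that \<open>i\<close> is a vector of
  independent uniform choices.

  Fix times \<open>\<tau> 0 < \<dots> < \<tau> (k - 1)\<close>, one in each window \<open>[(j + 1) m, (j + 2) m)\<close>, and ask that step
  \<open>\<tau> (j + 1)\<close> replaces the oldest vertex of the clique made by step \<open>\<tau> j\<close>. After these \<open>k\<close> steps the
  chosen clique has been replaced by a disjoint one, at the cost of \<open>k\<^sup>2 - 1\<close> mixed cliques. If no other step
  picks a mixed clique, the at most \<open>k\<^sup>2\<close> edges between the two end cliques form a cut. This is a product
  event in \<open>i\<close> of probability about \<open>m powr (1 - k) * (m / n) powr ((k\<^sup>2 - 1) / k)\<close>; the events for different
  \<open>\<tau>\<close> are almost uncorrelated or disjoint, so by Chebyshev's inequality one of them occurs as soon as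
  \<open>m\<close> is much larger than \<open>n powr ((k\<^sup>2 - 1) / (k\<^sup>2 + k - 1))\<close>.

  Given such an event, the cliques containing a fixed vertex of the cut grow like a Polya urn, and a
  supermartingale shows that its degree is typically at least about \<open>D = (n / m) powr ((k - 1) / k)\<close>.
  A round uses an edge of the cut with probability at most \<open>2 k\<^sup>2 / D\<close>, hence about \<open>D\<close> rounds are needed
  to cross it.
\<close>

subsection \<open>Clique numbering\<close>

text \<open>Cliques are lists sorted by age: the new vertex is appended at the end, so position
  \<open>r = 0\<close> always holds the oldest vertex. The guard \<open>i t < q\<close> is there for
  termination; it holds whenever \<open>i \<in> choices k\<close>.\<close>

function ktree_clique :: "nat \<Rightarrow> (nat \<Rightarrow> nat) \<Rightarrow> nat \<Rightarrow> nat list" where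
  "ktree_clique k i q =
     (let t = (q - 1) div k; r = (q - 1) mod k
      in if q = 0 then [0..<k]
         else if i t < q
           then take r (ktree_clique k i (i t)) @ drop (Suc r) (ktree_clique k i (i t)) @ [k + t]
           else [])"
  by auto
termination by (relation "Wellfounded.measure (\<lambda>(k, i, q). q)") auto

declare ktree_clique.simps [simp del]

definition ktree_edges :: "nat \<Rightarrow> (nat \<Rightarrow> nat) \<Rightarrow> nat \<Rightarrow> nat set set" where
  "ktree_edges k i n =
     clique_edges k \<union> (\<Union>t<n. {{k + t, c} | c. c \<in> set (ktree_clique k i (i t))})"

definition choices :: "nat \<Rightarrow> (nat \<Rightarrow> nat) set" where
  "choices k = {i. \<forall>t. i t \<le> k * t}"

lemma choicesD: "i \<in> choices k \<Longrightarrow> i t \<le> k * t"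
  by (simp add: choices_def)

lemma ktree_clique_0 [simp]: "ktree_clique k i 0 = [0..<k]"
  by (subst ktree_clique.simps) simp

lemma ktree_clique_step:
  assumes "i \<in> choices k" "r < k"
  shows "ktree_clique k i (k * t + 1 + r) =
     take r (ktree_clique k i (i t)) @ drop (Suc r) (ktree_clique k i (i t)) @ [k + t]"
proof -
  have "i t < k * t + 1 + r" using choicesD[OF assms(1), of t] by simp
  moreover have "(k * t + 1 + r - 1) div k = t" "(k * t + 1 + r - 1) mod k = r"
    using assms(2) by auto
  ultimately show ?thesis by (subst ktree_clique.simps) (simp add: Let_def)
qed

lemma clique_index_cases:
  fixes k q :: nat
  assumes "k > 0"
  obtains "q = 0" | t r where "q = k * t + 1 + r" "r < k"
proof (cases "q = 0")
  case False
  have "q = k * ((q - 1) div k) + 1 + (q - 1) mod k" using False by simp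
  with assms that(2) show ?thesis by (metis mod_less_divisor)
qed (use that in auto)

lemma clique_index_less:
  fixes k q n t r :: nat
  assumes "k * t + 1 + r \<le> k * n"
  shows "t < n"
proof (rule ccontr)
  assume "\<not> t < n"
  hence "k * n \<le> k * t" by simp
  with assms show False by simp
qed

lemma clique_index_inj:
  fixes k :: nat
  assumes "k * t + 1 + r = k * t' + 1 + r'" "r < k" "r' < k"
  shows "t = t' \<and> r = r'"
proof -
  have *: "(k * s + u) div k = s" if "u < k" for s u using that by auto
  have eq: "k * t + r = k * t' + r'" using assms by simp
  hence "t = t'" using *[OF assms(2), of t] *[OF assms(3), of t'] by metis
  with eq show ?thesis by simp
qed

lemma ktree_clique_basic:
  assumes "i \<in> choices k" "k > 0" "q \<le> k * n"
  shows "length (ktree_clique k i q) = k \<and> distinct (ktree_clique k i q)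
       \<and> set (ktree_clique k i q) \<subseteq> {..<k + n}"
  using assms(3)
proof (induction n arbitrary: q)
  case 0
  then show ?case by (auto simp: lessThan_atLeast0)
next
  case (Suc n)
  show ?case
  proof (cases "q \<le> k * n")
    case True
    with Suc.IH show ?thesis by fastforce
  next
    case False
    show ?thesis
    proof (rule clique_index_cases[OF assms(2), of q])
      fix t r assume 2: "q = k * t + 1 + r" "r < k"
      have "t < Suc n" using 2 Suc.prems by (intro clique_index_less) simp
      moreover have "\<not> t < n"
      proof
        assume "t < n"
        hence "k * Suc t \<le> k * n" by (intro mult_left_mono) auto
        with 2 False show False by simp
      qed
      ultimately have [simp]: "t = n" by simp
      have ih: "length (ktree_clique k i (i n)) = k" "distinct (ktree_clique k i (i n))"
        "set (ktree_clique k i (i n)) \<subseteq> {..<k + n}"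
        using Suc.IH[OF choicesD[OF assms(1), of n]] by auto
      let ?xs = "ktree_clique k i (i n)"
      have eq: "ktree_clique k i q = take r ?xs @ drop (Suc r) ?xs @ [k + n]"
        unfolding 2(1) using ktree_clique_step[OF assms(1) 2(2), of t] by simp
      have sub: "set (take r ?xs) \<subseteq> {..<k + n}" "set (drop (Suc r) ?xs) \<subseteq> {..<k + n}"
        using ih(3) set_take_subset set_drop_subset by fast+
      have "distinct (take r ?xs @ drop (Suc r) ?xs)"
        using ih(2) by (simp add: set_take_disj_set_drop_if_distinct)
      with sub ih(1) 2(2) show ?thesis unfolding eq by auto
    qed (use False in auto)
  qed
qed

lemma ktree_clique_length [simp]:
  "i \<in> choices k \<Longrightarrow> k > 0 \<Longrightarrow> length (ktree_clique k i q) = k"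
  using ktree_clique_basic[of i k q q] by (cases k) auto

lemma ktree_clique_distinct:
  "i \<in> choices k \<Longrightarrow> k > 0 \<Longrightarrow> distinct (ktree_clique k i q)"
  using ktree_clique_basic[of i k q q] by (cases k) auto

lemma ktree_clique_subset:
  "i \<in> choices k \<Longrightarrow> k > 0 \<Longrightarrow> q \<le> k * n \<Longrightarrow> set (ktree_clique k i q) \<subseteq> {..<k + n}"
  using ktree_clique_basic by blast

lemma ktree_clique_card:
  "i \<in> choices k \<Longrightarrow> k > 0 \<Longrightarrow> card (set (ktree_clique k i q)) = k"
  using ktree_clique_distinct[of i k q] by (simp add: distinct_card)

lemma set_remove_nth:
  assumes "distinct xs" "r < length xs"
  shows "set (take r xs @ drop (Suc r) xs) = set xs - {xs ! r}"
proof -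
  have xs: "xs = take r xs @ xs ! r # drop (Suc r) xs" using assms(2) by (rule id_take_nth_drop)
  have "distinct (take r xs @ xs ! r # drop (Suc r) xs)" using assms(1) xs by metis
  hence "xs ! r \<notin> set (take r xs @ drop (Suc r) xs)" by auto
  moreover have "set xs = insert (xs ! r) (set (take r xs @ drop (Suc r) xs))"
    by (subst xs) (simp add: insert_commute)
  ultimately show ?thesis by auto
qed

lemma set_ktree_clique_step:
  assumes "i \<in> choices k" "r < k"
  shows "set (ktree_clique k i (k * t + 1 + r)) =
     insert (k + t) (set (ktree_clique k i (i t)) - {ktree_clique k i (i t) ! r})"
proof -
  have "set (ktree_clique k i (k * t + 1 + r)) =
     insert (k + t) (set (take r (ktree_clique k i (i t)) @ drop (Suc r) (ktree_clique k i (i t))))"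
    unfolding ktree_clique_step[OF assms] by auto
  also have "\<dots> = insert (k + t) (set (ktree_clique k i (i t)) - {ktree_clique k i (i t) ! r})"
    using assms ktree_clique_distinct[OF assms(1)] by (subst set_remove_nth) auto
  finally show ?thesis .
qed

lemma ktree_clique_cong:
  assumes "i \<in> choices k" "i' \<in> choices k" "k > 0" "\<And>t. t < n \<Longrightarrow> i t = i' t" "q \<le> k * n"
  shows "ktree_clique k i q = ktree_clique k i' q"
  using assms(5)
proof (induction q rule: less_induct)
  case (less q)
  show ?case
  proof (rule clique_index_cases[OF assms(3), of q])
    fix t r assume 2: "q = k * t + 1 + r" "r < k"
    have t: "t < n" using 2 less.prems by (intro clique_index_less) simp
    have "i t < q" using choicesD[OF assms(1), of t] 2 by simp
    with less have "ktree_clique k i (i t) = ktree_clique k i' (i t)" by simp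
    with t 2 assms show ?thesis
      by (simp only: ktree_clique_step[OF assms(1)] ktree_clique_step[OF assms(2)])
  qed auto
qed

lemma doubleton_in_clique_edges_iff: "{u, v} \<in> clique_edges k \<longleftrightarrow> u < k \<and> v < k \<and> u \<noteq> v"
  by (auto simp: clique_edges_def doubleton_eq_iff)

lemma ktree_edges_Suc:
  "ktree_edges k i (Suc n) = ktree_edges k i n \<union> {{k + n, c} | c. c \<in> set (ktree_clique k i (i n))}"
  by (auto simp: ktree_edges_def lessThan_Suc)

lemma ktree_edges_bound:
  assumes "i \<in> choices k" "k > 0" "{u, v} \<in> ktree_edges k i n"
  shows "u < k + n \<and> v < k + n \<and> u \<noteq> v"
proof -
  have sub: "c < k + t" if "c \<in> set (ktree_clique k i (i t))" for t c
    using ktree_clique_subset[OF assms(1,2) choicesD[OF assms(1)]] that by blast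
  from assms(3) consider "u < k" "v < k" "u \<noteq> v"
    | t c where "t < n" "c \<in> set (ktree_clique k i (i t))" "{u, v} = {k + t, c}"
    by (auto simp: ktree_edges_def doubleton_in_clique_edges_iff)
  thus ?thesis
  proof cases
    case 2
    with sub[OF 2(2)] show ?thesis by (auto simp: doubleton_eq_iff)
  qed auto
qed

lemma ktree_edges_old:
  assumes "u < k + n" "v < k + n"
  shows "{u, v} \<in> ktree_edges k i (Suc n) \<longleftrightarrow> {u, v} \<in> ktree_edges k i n"
  using assms by (auto simp: ktree_edges_Suc doubleton_eq_iff)

lemma ktree_edges_new:
  assumes "i \<in> choices k" "k > 0"
  shows "{k + n, v} \<in> ktree_edges k i (Suc n) \<longleftrightarrow> v \<in> set (ktree_clique k i (i n))"
  using ktree_edges_bound[OF assms, of "k + n" v n]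
  by (auto simp: ktree_edges_Suc doubleton_eq_iff)

text \<open>A \<open>k\<close>-clique after step \<open>n\<close> that avoids the new vertex is an
  old one. One that contains it consists of the new vertex and \<open>k - 1\<close> vertices of its
  neighbourhood \<open>X\<close>, that is, \<open>X\<close> without one vertex, which is what the
  positions \<open>r < k\<close> enumerate. Injectivity is included because it turns a uniform
  clique into a uniform index.\<close>

lemma k_cliques_ktree:
  assumes i: "i \<in> choices k" and k: "k > 0"
  shows "k_cliques k {..<k + n} (ktree_edges k i n) = (\<lambda>q. set (ktree_clique k i q)) ` {..k * n}
       \<and> inj_on (\<lambda>q. set (ktree_clique k i q)) {..k * n}"
proof (induction n)
  case 0
  have "C = {..<k}" if "C \<subseteq> {..<k}" "card C = k" for C :: "nat set"
    using that card_subset_eq[of "{..<k}" C] by simp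
  moreover have "ktree_edges k i 0 = clique_edges k" by (simp add: ktree_edges_def)
  ultimately show ?case by (auto simp: k_cliques_def doubleton_in_clique_edges_iff lessThan_atLeast0)
next
  case (Suc n)
  define X where "X = set (ktree_clique k i (i n))"
  define V where "V = {..<k + n}"
  let ?c = "\<lambda>q. set (ktree_clique k i q)"
  have X: "X \<subseteq> V" "card X = k" "finite X"
    using ktree_clique_subset[OF i k choicesD[OF i, of n]] ktree_clique_card[OF i k, of "i n"]
    unfolding X_def V_def by simp_all
  have new: "?c (k * n + 1 + r) = insert (k + n) (X - {ktree_clique k i (i n) ! r})" if "r < k" for r
    using set_ktree_clique_step[OF i that] by (simp add: X_def)
  have idx: "{..k * Suc n} = {..k * n} \<union> (\<lambda>r. k * n + 1 + r) ` {..<k}" (is "?L = ?R")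
  proof (intro set_eqI iffI)
    fix q assume "q \<in> ?L"
    hence "q \<le> k * n \<or> q = k * n + 1 + (q - k * n - 1) \<and> q - k * n - 1 < k" using k by auto
    thus "q \<in> ?R" by (auto intro: rev_image_eqI)
  qed auto
  have old: "C \<in> k_cliques k {..<k + Suc n} (ktree_edges k i (Suc n)) \<and> k + n \<notin> C \<longleftrightarrow>
      C \<in> k_cliques k V (ktree_edges k i n)" for C
  proof -
    have "C \<subseteq> {..<k + Suc n} \<and> k + n \<notin> C \<longleftrightarrow> C \<subseteq> V" by (auto simp: V_def less_Suc_eq)
    moreover have "{u, v} \<in> ktree_edges k i (Suc n) \<longleftrightarrow> {u, v} \<in> ktree_edges k i n"
      if "C \<subseteq> V" "u \<in> C" "v \<in> C" for u v
      using that by (intro ktree_edges_old) (auto simp: V_def)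
    ultimately show ?thesis unfolding k_cliques_def by blast
  qed
  have clq_old: "{u, v} \<in> ktree_edges k i n" if "u \<in> X" "v \<in> X" "u \<noteq> v" for u v
  proof -
    have "X \<in> k_cliques k {..<k + n} (ktree_edges k i n)"
      using Suc.IH choicesD[OF i, of n] by (auto simp: X_def)
    with that show ?thesis by (auto simp: k_cliques_def)
  qed
  have nth_X: "(\<lambda>r. ktree_clique k i (i n) ! r) ` {..<k} = X"
    using ktree_clique_length[OF i k, of "i n"] by (auto simp: X_def set_conv_nth)
  have newc: "C \<in> k_cliques k {..<k + Suc n} (ktree_edges k i (Suc n)) \<and> k + n \<in> C \<longleftrightarrow>
      C \<in> (\<lambda>r. ?c (k * n + 1 + r)) ` {..<k}" (is "?l \<longleftrightarrow> ?r") for C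
  proof
    assume ?l
    hence C: "C \<subseteq> {..<k + Suc n}" "card C = k" "k + n \<in> C"
      and ed: "\<And>u v. u \<in> C \<Longrightarrow> v \<in> C \<Longrightarrow> u \<noteq> v \<Longrightarrow> {u, v} \<in> ktree_edges k i (Suc n)"
      by (auto simp: k_cliques_def)
    \<comment> \<open>\<open>D\<close> lies in the \<open>k\<close>-set \<open>X\<close> and has
      \<open>k - 1\<close> elements, so it misses exactly one \<open>x\<close>, whose position is
      the wanted \<open>r\<close>.\<close>
    define D where "D = C - {k + n}"
    have D: "D \<subseteq> X"
      using ed[OF C(3)] ktree_edges_new[OF i k, of n] by (auto simp: D_def X_def)
    have "finite C" using C(1) finite_subset by blast
    hence "card D = k - 1" using C by (simp add: D_def)
    hence "card (X - D) = 1"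
      using D X k by (subst card_Diff_subset) (auto intro: finite_subset)
    then obtain x where x: "X - D = {x}" by (auto simp: card_1_singleton_iff)
    then obtain r where r: "r < k" "x = ktree_clique k i (i n) ! r" using nth_X by auto
    have "C = insert (k + n) (X - {x})" using x D C(3) by (auto simp: D_def)
    with r new show ?r by auto
  next
    assume ?r
    then obtain r where r: "r < k" "C = insert (k + n) (X - {ktree_clique k i (i n) ! r})"
      using new by auto
    have in1: "ktree_clique k i (i n) ! r \<in> X" using nth_X r by auto
    have nX: "k + n \<notin> X" using X(1) by (auto simp: V_def)
    have "card C = k" using r in1 nX X k by simp
    moreover have "C \<subseteq> {..<k + Suc n}" using r X by (auto simp: V_def)
    moreover have "{u, v} \<in> ktree_edges k i (Suc n)" if "u \<in> C" "v \<in> C" "u \<noteq> v" for u v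
    proof -
      have *: "{k + n, w} \<in> ktree_edges k i (Suc n)" if "w \<in> X" for w
        using ktree_edges_new[OF i k] that by (simp add: X_def)
      consider "u = k + n" "v \<in> X" | "v = k + n" "u \<in> X" | "u \<in> X" "v \<in> X"
        using \<open>u \<in> C\<close> \<open>v \<in> C\<close> \<open>u \<noteq> v\<close> r by auto
      thus ?thesis
        using * clq_old \<open>u \<noteq> v\<close> by cases (auto simp: insert_commute ktree_edges_Suc)
    qed
    ultimately show ?l using r by (auto simp: k_cliques_def)
  qed
  have "k_cliques k {..<k + Suc n} (ktree_edges k i (Suc n)) = ?c ` {..k * Suc n}"
  proof -
    have "?c ` {..k * Suc n} = k_cliques k V (ktree_edges k i n) \<union> (\<lambda>r. ?c (k * n + 1 + r)) ` {..<k}"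
      unfolding idx using Suc.IH by (auto simp: V_def image_Un image_image)
    moreover have "C \<in> k_cliques k {..<k + Suc n} (ktree_edges k i (Suc n)) \<longleftrightarrow>
      C \<in> k_cliques k V (ktree_edges k i n) \<or> C \<in> (\<lambda>r. ?c (k * n + 1 + r)) ` {..<k}" for C
      unfolding old[symmetric] newc[symmetric] by metis
    ultimately show ?thesis by (intro set_eqI) simp
  qed
  moreover have "inj_on ?c {..k * Suc n}"
    unfolding idx
  proof (subst inj_on_Un, intro conjI)
    show "inj_on ?c {..k * n}" using Suc.IH by simp
    show "inj_on ?c ((\<lambda>r. k * n + 1 + r) ` {..<k})"
    proof (rule inj_onI, clarify)
      fix r r' assume r: "r < k" "r' < k" "?c (k * n + 1 + r) = ?c (k * n + 1 + r')"
      have "k + n \<notin> X" using X(1) by (auto simp: V_def)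
      hence "X - {ktree_clique k i (i n) ! r} = X - {ktree_clique k i (i n) ! r'}"
        using r(3) unfolding new[OF r(1)] new[OF r(2)] by (subst (asm) insert_ident) auto
      moreover have "ktree_clique k i (i n) ! r \<in> X" "ktree_clique k i (i n) ! r' \<in> X"
        using nth_X r by auto
      ultimately have "ktree_clique k i (i n) ! r = ktree_clique k i (i n) ! r'" by blast
      thus "k * n + 1 + r = k * n + 1 + r'"
        using r ktree_clique_distinct[OF i k] ktree_clique_length[OF i k]
        by (simp add: nth_eq_iff_index_eq)
    qed
    have "k + n \<notin> ?c q" if "q \<le> k * n" for q
      using ktree_clique_subset[OF i k that] by auto
    moreover have "k + n \<in> ?c (k * n + 1 + r)" if "r < k" for r
      using new[OF that] by blast
    ultimately show "?c ` ({..k * n} - (\<lambda>r. k * n + 1 + r) ` {..<k}) \<inter>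
        ?c ` ((\<lambda>r. k * n + 1 + r) ` {..<k} - {..k * n}) = {}"
      by fastforce
  qed
  ultimately show ?case by blast
qed

section \<open>The random \<open>k\<close>-tree as the image of independent uniform indices\<close>

definition choice_pmf :: "nat \<Rightarrow> nat \<Rightarrow> (nat \<Rightarrow> nat) pmf" where
  "choice_pmf k n = Pi_pmf {..<n} 0 (\<lambda>t. pmf_of_set {..k * t})"

text \<open>At times \<open>t \<ge> n\<close> the value is the default \<open>0\<close>, which also
  satisfies the bound in \<open>choices k\<close>; hence no horizon has to be carried along.\<close>

lemma set_choice_pmf: "set_pmf (choice_pmf k n) \<subseteq> choices k"
  by (auto simp: choice_pmf_def set_Pi_pmf PiE_dflt_def choices_def set_pmf_of_set)
     (metis atMost_iff le0)

lemma ktree_edges_upd: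
  assumes "i \<in> choices k" "k > 0" "x \<le> k * n"
  shows "ktree_edges k (i(n := x)) (Suc n) =
    ktree_edges k i n \<union> {{k + n, c} | c. c \<in> set (ktree_clique k i x)}"
proof -
  have i': "i(n := x) \<in> choices k" using assms by (auto simp: choices_def)
  have *: "ktree_clique k (i(n := x)) q = ktree_clique k i q" if "q \<le> k * n" for q
    using ktree_clique_cong[OF i' assms(1,2) _ that] by simp
  have "i t \<le> k * n" if "t < n" for t
    using choicesD[OF assms(1), of t] that by (meson le_trans less_imp_le mult_le_mono2)
  hence "ktree_edges k (i(n := x)) n = ktree_edges k i n"
    unfolding ktree_edges_def using * by (intro arg_cong2[of _ _ _ _ "(\<union>)"] SUP_cong) auto
  with * assms show ?thesis by (simp add: ktree_edges_Suc)
qed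

text \<open>The number \<open>k * n + 1\<close> of cliques before step \<open>n\<close> does not
  depend on the earlier choices. With the bijection between indices and cliques, each uniform choice
  of a clique becomes a uniform index independent of the past.\<close>

lemma random_ktree_eq:
  assumes "k > 0"
  shows "random_ktree k n = map_pmf (\<lambda>i. ktree_edges k i n) (choice_pmf k n)"
proof (induction n)
  case 0
  show ?case by (simp add: choice_pmf_def ktree_edges_def)
next
  case (Suc n)
  have "random_ktree k (Suc n) = choice_pmf k n \<bind> (\<lambda>i.
       map_pmf (\<lambda>C. ktree_edges k i n \<union> {{k + n, c} | c. c \<in> C})
               (pmf_of_set (k_cliques k {..<k + n} (ktree_edges k i n))))"
    by (simp add: Suc.IH bind_map_pmf)
  also have "\<dots> = choice_pmf k n \<bind> (\<lambda>i.
       map_pmf (\<lambda>x. ktree_edges k (i(n := x)) (Suc n)) (pmf_of_set {..k * n}))"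
  proof (intro bind_pmf_cong refl)
    fix i assume "i \<in> set_pmf (choice_pmf k n)"
    hence i: "i \<in> choices k" using set_choice_pmf by blast
    have "pmf_of_set (k_cliques k {..<k + n} (ktree_edges k i n))
        = map_pmf (\<lambda>q. set (ktree_clique k i q)) (pmf_of_set {..k * n})"
      using k_cliques_ktree[OF i assms] by (subst map_pmf_of_set_inj) auto
    thus "map_pmf (\<lambda>C. ktree_edges k i n \<union> {{k + n, c} | c. c \<in> C})
               (pmf_of_set (k_cliques k {..<k + n} (ktree_edges k i n)))
        = map_pmf (\<lambda>x. ktree_edges k (i(n := x)) (Suc n)) (pmf_of_set {..k * n})"
      by (auto simp: pmf.map_comp o_def ktree_edges_upd[OF i assms] intro!: map_pmf_cong)
  qed
  also have "\<dots> = map_pmf (\<lambda>i. ktree_edges k i (Suc n)) (choice_pmf k (Suc n))"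
    unfolding choice_pmf_def lessThan_Suc
    by (subst Pi_pmf_insert')
       (auto simp: map_bind_pmf map_pmf_def bind_assoc_pmf bind_return_pmf
             intro: bind_commute_pmf)
  finally show ?case .
qed

subsection \<open>The barrier\<close>

text \<open>The mixed cliques. In a chain, every clique created at a time \<open>\<tau> j\<close>
  contains the new vertex and still a vertex of the initial clique, except for \<open>r = 0\<close>
  at the last time: there the only remaining old vertex is removed. That index is the end clique and
  is taken out.\<close>

definition forbidden :: "nat \<Rightarrow> (nat \<Rightarrow> nat) \<Rightarrow> nat set" where
  "forbidden k \<tau> = (\<lambda>(j, r). k * \<tau> j + 1 + r) ` ({..<k} \<times> {..<k}) - {k * \<tau> (k - 1) + 1}"

text \<open>The admissible values of \<open>i t\<close>. For injective \<open>\<tau>\<close> the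
  comprehension is a singleton. Time \<open>\<tau> 0\<close> falls under the second case, so the
  initial clique of the chain is free.\<close>

definition chain_steps :: "nat \<Rightarrow> (nat \<Rightarrow> nat) \<Rightarrow> nat \<Rightarrow> nat set" where
  "chain_steps k \<tau> t =
     (if t \<in> \<tau> ` {1..<k} then {k * \<tau> j + 1 | j. Suc j < k \<and> \<tau> (Suc j) = t}
      else {..k * t} - forbidden k \<tau>)"

inductive_set descendants :: "nat \<Rightarrow> (nat \<Rightarrow> nat) \<Rightarrow> nat \<Rightarrow> nat set"
  for k i c where
  self: "c \<in> descendants k i c"
| step: "i t \<in> descendants k i c \<Longrightarrow> r < k \<Longrightarrow> k * t + 1 + r \<in> descendants k i c"

lemma descendants_ge:
  assumes "q \<in> descendants k i c" "i \<in> choices k"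
  shows "q \<ge> c"
  using assms(1)
proof induction
  case (step t r)
  with choicesD[OF assms(2), of t] show ?case by simp
qed simp

lemma descendants_stepD:
  assumes "k * t + 1 + r \<in> descendants k i c" "r < k" "k * t + 1 + r \<noteq> c"
  shows "i t \<in> descendants k i c"
  using assms(1)
proof (cases rule: descendants.cases)
  case (step t' r')
  with clique_index_inj[of k t r t' r'] assms(2) show ?thesis by simp
qed (use assms(3) in simp)

locale barrier_chain =
  fixes k n :: nat and \<tau> i :: "nat \<Rightarrow> nat"
  assumes k2: "k \<ge> 2"
    and choices: "i \<in> choices k"
    and mono: "\<And>j l. j < l \<Longrightarrow> l < k \<Longrightarrow> \<tau> j < \<tau> l"
    and bound: "\<And>j. j < k \<Longrightarrow> \<tau> j < n"
    and steps: "\<And>t. t < n \<Longrightarrow> i t \<in> chain_steps k \<tau> t"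
begin

text \<open>Besides the chain vertices, this collects every vertex attached to a descendant of the
  end clique. Since \<open>t\<close> ranges over all times, numbers beyond the vertex set may occur;
  they are cut off where the set is used as a side of the graph.\<close>

definition far_side :: "nat set" where
  "far_side = (\<lambda>j. k + \<tau> j) ` {..<k} \<union> {k + t | t. i t \<in> descendants k i (k * \<tau> (k - 1) + 1)}"

definition near_clique :: "nat set" where
  "near_clique = set (ktree_clique k i (i (\<tau> 0)))"

definition far_clique :: "nat set" where
  "far_clique = (\<lambda>j. k + \<tau> j) ` {..<k}"

lemma k0: "k > 0"
  using k2 by simp

lemma inj: "j < k \<Longrightarrow> l < k \<Longrightarrow> \<tau> j = \<tau> l \<Longrightarrow> j = l"
  using mono[of j l] mono[of l j] by (cases j l rule: linorder_cases) auto

lemma pick: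
  assumes "Suc j < k"
  shows "i (\<tau> (Suc j)) = k * \<tau> j + 1"
proof -
  have "\<tau> (Suc j) \<in> \<tau> ` {1..<k}" using assms by auto
  with steps[OF bound[OF assms]]
  obtain j' where j': "i (\<tau> (Suc j)) = k * \<tau> j' + 1" "Suc j' < k" "\<tau> (Suc j') = \<tau> (Suc j)"
    by (auto simp: chain_steps_def)
  have "j' = j" using inj[of "Suc j'" "Suc j"] j' assms by simp
  with j' show ?thesis by simp
qed

lemma avoid:
  assumes "t < n" "t \<notin> \<tau> ` {1..<k}"
  shows "i t \<notin> forbidden k \<tau>"
  using steps[OF assms(1)] assms(2) by (auto simp: chain_steps_def)

text \<open>The list works as a queue: a chain step drops its head and appends the new vertex, so
  after \<open>j\<close> steps exactly the \<open>j\<close> oldest vertices of the initial clique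
  have been replaced.\<close>

lemma chain_clique:
  assumes "j < k"
  shows "ktree_clique k i (i (\<tau> j)) =
     drop j (ktree_clique k i (i (\<tau> 0))) @ map (\<lambda>l. k + \<tau> l) [0..<j]"
  using assms
proof (induction j)
  case (Suc j)
  let ?C = "ktree_clique k i (i (\<tau> 0))"
  have len: "j < length ?C" using Suc.prems choices k0 by simp
  have "ktree_clique k i (i (\<tau> (Suc j))) = ktree_clique k i (k * \<tau> j + 1 + 0)"
    using pick[OF Suc.prems] by simp
  also have "\<dots> = drop 1 (drop j ?C @ map (\<lambda>l. k + \<tau> l) [0..<j]) @ [k + \<tau> j]"
    using ktree_clique_step[OF choices k0, of "\<tau> j"] Suc.IH Suc.prems by simp
  also have "\<dots> = drop (Suc j) ?C @ map (\<lambda>l. k + \<tau> l) [0..<Suc j]"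
    using len by simp
  finally show ?case .
qed simp

lemma last_clique: "set (ktree_clique k i (k * \<tau> (k - 1) + 1)) = far_clique"
proof -
  have len: "length (ktree_clique k i (i (\<tau> 0))) = k" using choices k0 by simp
  have "ktree_clique k i (k * \<tau> (k - 1) + 1 + 0) =
      drop 1 (ktree_clique k i (i (\<tau> (k - 1)))) @ [k + \<tau> (k - 1)]"
    using ktree_clique_step[OF choices k0, of "\<tau> (k - 1)"] by simp
  also have "\<dots> = map (\<lambda>l. k + \<tau> l) [0..<k - 1] @ [k + \<tau> (k - 1)]"
    using chain_clique[of "k - 1"] k0 len by simp
  also have "\<dots> = map (\<lambda>l. k + \<tau> l) [0..<Suc (k - 1)]" by simp
  also have "Suc (k - 1) = k" using k0 by simp
  finally show ?thesis by (simp add: far_clique_def lessThan_atLeast0)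
qed

lemma chain_index_forbidden:
  assumes "j < k" "r < k" "k * \<tau> j + 1 + r \<notin> forbidden k \<tau>"
  shows "k * \<tau> j + 1 + r = k * \<tau> (k - 1) + 1"
  using assms unfolding forbidden_def by force

lemma first_not_far: "u < k \<Longrightarrow> u \<notin> far_side"
  by (auto simp: far_side_def)

text \<open>Induction over the index. Outside the chain times the picked clique is not forbidden,
  hence lies on one side, and the new vertex joins that same side by definition of
  \<open>far_side\<close>; so do all cliques it creates. The chain times create forbidden cliques
  and the end clique.\<close>

lemma clique_one_sided:
  assumes "q \<le> k * n" "q \<notin> forbidden k \<tau>"
  shows "(q \<in> descendants k i (k * \<tau> (k - 1) + 1) \<longrightarrow> set (ktree_clique k i q) \<subseteq> far_side) \<and>
         (q \<notin> descendants k i (k * \<tau> (k - 1) + 1) \<longrightarrow> set (ktree_clique k i q) \<inter> far_side = {})"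
  using assms
proof (induction q rule: less_induct)
  case (less q)
  define c where "c = k * \<tau> (k - 1) + 1"
  have "(q \<in> descendants k i c \<longrightarrow> set (ktree_clique k i q) \<subseteq> far_side) \<and>
        (q \<notin> descendants k i c \<longrightarrow> set (ktree_clique k i q) \<inter> far_side = {})"
  proof (rule clique_index_cases[OF k0, of q])
    assume q: "q = 0"
    have "q \<notin> descendants k i c" using descendants_ge[OF _ choices, of q c] q by (auto simp: c_def)
    moreover have "set (ktree_clique k i q) \<inter> far_side = {}" using q first_not_far by auto
    ultimately show ?thesis by simp
  next
    fix t r assume q: "q = k * t + 1 + r" "r < k"
    have t: "t < n" using q less.prems clique_index_less by blast
    show ?thesis
    proof (cases "t \<in> \<tau> ` {..<k}")
      case True
      then obtain j where "j < k" "t = \<tau> j" by auto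
      with chain_index_forbidden[of j r] q less.prems have "q = c" by (auto simp: c_def)
      thus ?thesis using last_clique descendants.self by (auto simp: c_def far_side_def far_clique_def)
    next
      case False
      \<comment> \<open>Thus membership of \<open>q\<close> in the descendants can only stem from
        the rule \<open>step\<close>, and is equivalent to that of its parent
        \<open>i t\<close>.\<close>
      have nc: "q \<noteq> c"
      proof
        assume "q = c"
        hence "k * t + 1 + r = k * \<tau> (k - 1) + 1 + 0" using q(1) unfolding c_def by linarith
        from clique_index_inj[OF this q(2) k0] have "t = \<tau> (k - 1)" by simp
        with False k0 show False by auto
      qed
      have "t \<notin> \<tau> ` {1..<k}" using False by auto
      from avoid[OF t this] have av: "i t \<notin> forbidden k \<tau>" .
      have lt: "i t < q" "i t \<le> k * n"
        using choicesD[OF choices, of t] q t less.prems(1) by auto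
      note IH = less.IH[OF lt av, folded c_def]
      have sub: "set (ktree_clique k i q) \<subseteq> insert (k + t) (set (ktree_clique k i (i t)))"
        using set_ktree_clique_step[OF choices q(2), of t] unfolding q(1) by auto
      show ?thesis
      proof (intro conjI impI)
        assume "q \<in> descendants k i c"
        hence d: "i t \<in> descendants k i c" using descendants_stepD[of k t r i c] q nc by simp
        hence "k + t \<in> far_side" by (auto simp: far_side_def c_def)
        with d IH sub show "set (ktree_clique k i q) \<subseteq> far_side" by blast
      next
        assume "q \<notin> descendants k i c"
        hence d: "i t \<notin> descendants k i c" using descendants.step q by blast
        hence "k + t \<notin> far_side" using False by (auto simp: far_side_def c_def)
        with d IH sub show "set (ktree_clique k i q) \<inter> far_side = {}" by blast
      qed
    qed
  qed
  thus ?case unfolding c_def .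
qed

text \<open>An edge to the far side arises when some vertex \<open>k + t\<close> is joined to clique
  \<open>i t\<close>. If \<open>t\<close> is not a chain time, clique and vertex are on the same
  side and nothing crosses. At a chain time the clique consists of earlier chain vertices, which are
  far, and of vertices of the initial clique.\<close>

lemma crossing_edge:
  assumes "{u, v} \<in> ktree_edges k i n" "u \<in> far_side" "v \<notin> far_side"
  shows "u \<in> far_clique \<and> v \<in> near_clique"
proof -
  define c where "c = k * \<tau> (k - 1) + 1"
  have "{u, v} \<notin> clique_edges k" using first_not_far assms(2) by (auto simp: doubleton_in_clique_edges_iff)
  then obtain t x where t: "t < n" "x \<in> set (ktree_clique k i (i t))" "{u, v} = {k + t, x}"
    using assms(1) by (auto simp: ktree_edges_def)
  show ?thesis
  proof (cases "t \<in> \<tau> ` {..<k}")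
    case True
    then obtain j where j: "j < k" "t = \<tau> j" by auto
    hence far: "k + t \<in> far_clique" "k + t \<in> far_side" by (auto simp: far_clique_def far_side_def)
    with t assms have uv: "u = k + t" "v = x" by (auto simp: doubleton_eq_iff)
    have "x \<in> set (drop j (ktree_clique k i (i (\<tau> 0)))) \<or> x \<in> far_side"
      using t(2) chain_clique[OF j(1)] j by (auto simp: far_side_def)
    hence "x \<in> near_clique" using uv assms(3) by (auto simp: near_clique_def dest: in_set_dropD)
    with far uv show ?thesis by simp
  next
    case False
    have "t \<notin> \<tau> ` {1..<k}" using False by auto
    from avoid[OF t(1) this] have av: "i t \<notin> forbidden k \<tau>" .
    have "i t \<le> k * n"
      using choicesD[OF choices, of t] t(1) by (meson le_trans less_imp_le mult_le_mono2)
    note side = clique_one_sided[OF this av, folded c_def]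
    have "(k + t \<in> far_side) = (x \<in> far_side)"
    proof (cases "i t \<in> descendants k i c")
      case True
      hence "k + t \<in> far_side" by (auto simp: far_side_def c_def)
      with True side t(2) show ?thesis by blast
    next
      case d: False
      hence "k + t \<notin> far_side" using False by (auto simp: far_side_def c_def)
      with d side t(2) show ?thesis by blast
    qed
    with t(3) assms(2,3) have False by (auto simp: doubleton_eq_iff)
    thus ?thesis ..
  qed
qed

lemma far_side_nontrivial: "k + \<tau> 0 \<in> far_side" "k + \<tau> 0 < k + n" "0 \<notin> far_side"
  using k0 bound[of 0] first_not_far by (auto simp: far_side_def)

lemma card_barrier: "card near_clique = k" "card far_clique = k" "finite near_clique" "finite far_clique"
proof -
  have "inj_on (\<lambda>j. k + \<tau> j) {..<k}" using inj by (auto intro: inj_onI)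
  thus "card far_clique = k" by (simp add: far_clique_def card_image)
qed (use ktree_clique_card[OF choices k0] in \<open>auto simp: near_clique_def far_clique_def\<close>)

end

section \<open>Lower bounds for degrees, and existence of neighbors\<close>

definition picks :: "nat \<Rightarrow> (nat \<Rightarrow> nat) \<Rightarrow> nat \<Rightarrow> nat \<Rightarrow> nat \<Rightarrow> nat" where
  "picks k i v M n = card {t \<in> {M..<n}. v \<in> set (ktree_clique k i (i t))}"

lemma nbrs_ktree_subset:
  assumes "i \<in> choices k" "k > 0"
  shows "nbrs (ktree_edges k i n) v \<subseteq> {..<k + n}"
  using ktree_edges_bound[OF assms] by (auto simp: nbrs_def)

lemma picks_le_degree:
  assumes "i \<in> choices k" "k > 0"
  shows "picks k i v M n \<le> card (nbrs (ktree_edges k i n) v)"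
proof -
  let ?T = "{t \<in> {M..<n}. v \<in> set (ktree_clique k i (i t))}"
  have "picks k i v M n = card ((\<lambda>t. k + t) ` ?T)"
    by (simp add: picks_def card_image)
  also have "\<dots> \<le> card (nbrs (ktree_edges k i n) v)"
  proof (rule card_mono)
    show "finite (nbrs (ktree_edges k i n) v)"
      using nbrs_ktree_subset[OF assms] finite_subset by blast
    show "(\<lambda>t. k + t) ` ?T \<subseteq> nbrs (ktree_edges k i n) v"
      by (auto simp: nbrs_def ktree_edges_def)
  qed
  finally show ?thesis .
qed

text \<open>Guarantees that \<open>pmf_of_set\<close> is applied to nonempty neighborhoods in the
  protocol. Among the first \<open>k\<close> vertices a neighbor exists because
  \<open>k \<ge> 2\<close>; a later vertex is adjacent to the clique it was attached to.\<close>

lemma nbrs_ktree_nonempty: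
  assumes "i \<in> choices k" "k \<ge> 2" "v < k + n"
  shows "nbrs (ktree_edges k i n) v \<noteq> {}"
proof (cases "v < k")
  case True
  define u where "u = (if v = 0 then 1 else 0 :: nat)"
  have "{u, v} \<in> ktree_edges k i n"
    using True assms(2) by (auto simp: ktree_edges_def doubleton_in_clique_edges_iff u_def)
  thus ?thesis by (auto simp: nbrs_def)
next
  case False
  define t where "t = v - k"
  have t: "v = k + t" "t < n" using False assms(3) by (auto simp: t_def)
  have "ktree_clique k i (i t) \<noteq> []"
    using ktree_clique_length[OF assms(1), of "i t"] assms(2) by fastforce
  then obtain c where "c \<in> set (ktree_clique k i (i t))" by fastforce
  hence "{c, v} \<in> ktree_edges k i n"
    using t by (auto simp: ktree_edges_def intro!: bexI[of _ t] exI[of _ c])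
  thus ?thesis by (auto simp: nbrs_def)
qed

subsection \<open>Crossing a cut\<close>

lemma measure_Pi_pmf_component:
  assumes "finite A" "x \<in> A"
  shows "measure_pmf.prob (Pi_pmf A d p) {c. P (c x)} = measure_pmf.prob (p x) {y. P y}"
proof -
  have "measure_pmf.prob (p x) {y. P y} = measure_pmf.prob (map_pmf (\<lambda>f. f x) (Pi_pmf A d p)) {y. P y}"
    using assms by (simp add: Pi_pmf_component)
  thus ?thesis by (simp add: vimage_def)
qed

text \<open>Serves twice: to split off the last round of the protocol, and to split off the random
  graph from the spreading of the rumor.\<close>

lemma measure_bind_pmf_le_add:
  assumes "\<And>x. x \<in> set_pmf p \<Longrightarrow> x \<notin> B \<Longrightarrow> measure_pmf.prob (q x) A \<le> e" "e \<ge> 0"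
  shows "measure_pmf.prob (p \<bind> q) A \<le> measure_pmf.prob p B + e"
proof -
  have "measure_pmf.prob (p \<bind> q) A = measure_pmf.expectation p (\<lambda>x. measure_pmf.prob (q x) A)"
    unfolding measure_pmf_bind
    using measurable_measure_pmf[of q]
    by (intro measure_pmf.measure_bind[where N = "count_space UNIV"]) auto
  also have "\<dots> \<le> measure_pmf.expectation p (\<lambda>x. indicator B x + e)"
  proof (rule integral_mono_AE)
    show "integrable (measure_pmf p) (\<lambda>x. measure_pmf.prob (q x) A)"
      by (rule measure_pmf.integrable_const_bound[where B = 1]) auto
    show "integrable (measure_pmf p) (\<lambda>x. indicator B x + e)"
      by (rule measure_pmf.integrable_const_bound[where B = "1 + e"])
         (auto simp: indicator_def assms(2))
    show "AE x in measure_pmf p. measure_pmf.prob (q x) A \<le> indicator B x + e"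
      using assms measure_pmf.prob_le_1[of _ A]
      by (auto simp: AE_measure_pmf_iff indicator_def intro: order_trans add_increasing2)
  qed
  also have "\<dots> = measure_pmf.prob p B + e"
    by (subst Bochner_Integration.integral_add)
       (auto intro!: measure_pmf.integrable_const_bound[where B = 1])
  finally show ?thesis .
qed

text \<open>The rumor can only leave \<open>S\<close> in a round where some contact joins \<open>S\<close> to its complement.\<close>
lemma pp_round_escape:
  assumes V: "finite V" and nb: "\<And>v. v \<in> V \<Longrightarrow> nbrs E v \<noteq> {} \<and> nbrs E v \<subseteq> V"
    and S: "S \<subseteq> V" and I: "I \<subseteq> S"
  shows "measure_pmf.prob (pp_round V E I) {J. \<not> J \<subseteq> S}
       \<le> (\<Sum>v\<in>V. card {u \<in> nbrs E v. (u \<in> S) \<noteq> (v \<in> S)} / card (nbrs E v))"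
proof -
  let ?P = "Pi_pmf V undefined (\<lambda>v. pmf_of_set (nbrs E v))"
  have fin: "finite (nbrs E v)" if "v \<in> V" for v using nb[OF that] V finite_subset by blast
  have "measure_pmf.prob (pp_round V E I) {J. \<not> J \<subseteq> S}
      = measure_pmf.prob ?P {c. \<not> I \<union> {v \<in> V. c v \<in> I} \<union> c ` I \<subseteq> S}"
    by (simp add: pp_round_def vimage_def)
  also have "\<dots> \<le> measure_pmf.prob ?P (\<Union>v\<in>V. {c. (c v \<in> S) \<noteq> (v \<in> S)})"
    using I S by (intro measure_pmf.finite_measure_mono) auto
  also have "\<dots> \<le> (\<Sum>v\<in>V. measure_pmf.prob ?P {c. (c v \<in> S) \<noteq> (v \<in> S)})"
    using V by (intro measure_pmf.finite_measure_subadditive_finite) auto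
  also have "\<dots> = (\<Sum>v\<in>V. card {u \<in> nbrs E v. (u \<in> S) \<noteq> (v \<in> S)} / card (nbrs E v))"
  proof (rule sum.cong)
    fix v assume v: "v \<in> V"
    have "measure_pmf.prob ?P {c. (c v \<in> S) \<noteq> (v \<in> S)} =
        measure_pmf.prob (pmf_of_set (nbrs E v)) {u. (u \<in> S) \<noteq> (v \<in> S)}"
      using measure_Pi_pmf_component[OF V v, of undefined _ "\<lambda>u. (u \<in> S) \<noteq> (v \<in> S)"] by simp
    also have "\<dots> = card (nbrs E v \<inter> {u. (u \<in> S) \<noteq> (v \<in> S)}) / card (nbrs E v)"
      using nb v fin by (subst measure_pmf_of_set) auto
    also have "nbrs E v \<inter> {u. (u \<in> S) \<noteq> (v \<in> S)} = {u \<in> nbrs E v. (u \<in> S) \<noteq> (v \<in> S)}" by blast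
    finally show "measure_pmf.prob ?P {c. (c v \<in> S) \<noteq> (v \<in> S)} =
      card {u \<in> nbrs E v. (u \<in> S) \<noteq> (v \<in> S)} / card (nbrs E v)" .
  qed simp
  finally show ?thesis .
qed

lemma set_pp_trace_nonempty: "tr \<in> set_pmf (pp_trace V E s m) \<Longrightarrow> tr \<noteq> []"
  by (cases m) auto

text \<open>The one-round bound is uniform in the informed set \<open>I \<subseteq> S\<close>, so a
  union bound over the rounds suffices and the actual spread inside \<open>S\<close> is
  irrelevant.\<close>

lemma pp_trace_escape:
  assumes step: "\<And>I. I \<subseteq> S \<Longrightarrow> measure_pmf.prob (pp_round V E I) {J. \<not> J \<subseteq> S} \<le> e"
    and "e \<ge> 0" "s \<in> S"
  shows "measure_pmf.prob (pp_trace V E s m) {tr. \<exists>I\<in>set tr. \<not> I \<subseteq> S} \<le> real m * e"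
proof (induction m)
  case 0
  show ?case using assms(3) by (simp add: measure_return_pmf)
next
  case (Suc m)
  let ?B = "{tr. \<exists>I\<in>set tr. \<not> I \<subseteq> S}"
  have "measure_pmf.prob (pp_trace V E s (Suc m)) ?B \<le> measure_pmf.prob (pp_trace V E s m) ?B + e"
    unfolding pp_trace.simps
  proof (rule measure_bind_pmf_le_add[OF _ assms(2)])
    fix tr assume tr: "tr \<in> set_pmf (pp_trace V E s m)" "tr \<notin> ?B"
    hence "last tr \<subseteq> S" using set_pp_trace_nonempty[OF tr(1)] last_in_set by blast
    moreover have "(\<lambda>I. tr @ [I]) -` ?B = {J. \<not> J \<subseteq> S}" using tr by auto
    ultimately show "measure_pmf.prob (map_pmf (\<lambda>I. tr @ [I]) (pp_round V E (last tr))) ?B \<le> e"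
      using step by simp
  qed
  with Suc.IH show ?case by (simp add: algebra_simps)
qed

subsection \<open>Second moment\<close>

lemma pmf_markov:
  assumes "\<And>x. x \<in> set_pmf p \<Longrightarrow> 0 \<le> f x" "finite (set_pmf p)" "c > 0"
  shows "measure_pmf.prob p {x. f x \<ge> c} \<le> measure_pmf.expectation p f / c"
proof -
  have "measure_pmf.prob p {x. f x \<ge> c} * c = measure_pmf.expectation p (\<lambda>x. indicator {x. f x \<ge> c} x * c)"
    by simp
  also have "\<dots> \<le> measure_pmf.expectation p f"
    using assms
    by (intro integral_mono_AE integrable_measure_pmf_finite)
       (auto simp: AE_measure_pmf_iff indicator_def)
  finally show ?thesis using assms(3) by (simp add: field_simps)
qed

text \<open>\<open>A \<tau>\<close> is the wanted event and \<open>B \<tau>\<close> a defect. Let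
  \<open>X\<close> count the events \<open>A \<tau>\<close> that occur and \<open>Y\<close> those
  with a defect. If none occurs without a defect, then \<open>X = Y\<close>, hence \<open>X\<close>
  is below half its mean or \<open>Y\<close> is at least half the mean of \<open>X\<close>;
  Chebyshev's and Markov's inequalities bound these two cases.\<close>

lemma second_moment_good_event:
  fixes A B :: "'t \<Rightarrow> 'a set" and P :: "'t \<Rightarrow> real" and M :: "'a pmf"
  assumes fin: "finite T" "finite (set_pmf M)"
    and P: "\<And>\<tau>. \<tau> \<in> T \<Longrightarrow> measure_pmf.prob M (A \<tau>) = P \<tau>"
    and pair: "\<And>\<tau> \<tau>'. \<tau> \<in> T \<Longrightarrow> \<tau>' \<in> T \<Longrightarrow> \<tau> \<noteq> \<tau>' \<Longrightarrow>
       measure_pmf.prob M (A \<tau> \<inter> A \<tau>') \<le> c * (P \<tau> * P \<tau>')"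
    and bad: "\<And>\<tau>. \<tau> \<in> T \<Longrightarrow> measure_pmf.prob M (A \<tau> \<inter> B \<tau>) \<le> \<delta> * P \<tau>"
    and \<mu>: "(\<Sum>\<tau>\<in>T. P \<tau>) = \<mu>" "\<mu> > 0" and c: "c \<ge> 0"
  shows "measure_pmf.prob M {x. \<not> (\<exists>\<tau>\<in>T. x \<in> A \<tau> - B \<tau>)} \<le> 4 * (1 / \<mu> + (c - 1)) + 2 * \<delta>"
proof -
  define X where "X x = (\<Sum>\<tau>\<in>T. indicator (A \<tau>) x :: real)" for x
  define Y where "Y x = (\<Sum>\<tau>\<in>T. indicator (A \<tau> \<inter> B \<tau>) x :: real)" for x
  let ?E = "measure_pmf.expectation M"
  have int [simp]: "integrable M f" for f :: "'a \<Rightarrow> real"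
    by (rule integrable_measure_pmf_finite[OF fin(2)])
  have P0: "P \<tau> \<ge> 0" if "\<tau> \<in> T" for \<tau> using P[OF that] measure_nonneg by metis
  have EX: "?E X = \<mu>" unfolding X_def by (simp add: P \<mu>(1)[symmetric])
  have EY: "?E Y \<le> \<delta> * \<mu>"
    unfolding Y_def by (simp add: \<mu>(1)[symmetric] sum_distrib_left bad sum_mono)
  have "?E (\<lambda>x. (X x)\<^sup>2) = ?E (\<lambda>x. \<Sum>\<tau>\<in>T. \<Sum>\<tau>'\<in>T. indicator (A \<tau> \<inter> A \<tau>') x)"
    by (simp add: X_def power2_eq_square sum_product indicator_inter_arith)
  also have "\<dots> = (\<Sum>\<tau>\<in>T. \<Sum>\<tau>'\<in>T. measure_pmf.prob M (A \<tau> \<inter> A \<tau>'))"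
    by simp
  \<comment> \<open>The diagonal contributes \<open>P \<tau>\<close>. Adding the nonnegative term
    \<open>c * (P \<tau> * P \<tau>)\<close> there as well completes the off-diagonal part to a full
    square.\<close>
  also have "\<dots> \<le> (\<Sum>\<tau>\<in>T. \<Sum>\<tau>'\<in>T. (if \<tau> = \<tau>' then P \<tau> else 0) + c * (P \<tau> * P \<tau>'))"
    using pair P P0 c by (intro sum_mono) auto
  also have "\<dots> = (\<Sum>\<tau>\<in>T. P \<tau>) + c * ((\<Sum>\<tau>\<in>T. P \<tau>) * (\<Sum>\<tau>\<in>T. P \<tau>))"
    using fin(1) unfolding sum_product by (simp add: sum.distrib sum_distrib_left)
  finally have EX2: "?E (\<lambda>x. (X x)\<^sup>2) \<le> \<mu> + c * \<mu>\<^sup>2" by (simp add: \<mu>(1) power2_eq_square)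
  have "?E (\<lambda>x. (X x - \<mu>)\<^sup>2) = ?E (\<lambda>x. (X x)\<^sup>2 - 2 * \<mu> * X x + \<mu>\<^sup>2)"
    by (intro Bochner_Integration.integral_cong) (auto simp: power2_eq_square algebra_simps)
  also have "\<dots> = ?E (\<lambda>x. (X x)\<^sup>2) - \<mu>\<^sup>2"
    by (simp add: EX power2_eq_square)
  finally have Var: "?E (\<lambda>x. (X x - \<mu>)\<^sup>2) \<le> \<mu> + (c - 1) * \<mu>\<^sup>2"
    using EX2 by (simp add: algebra_simps)
  have XY: "X x = Y x" if "\<not> (\<exists>\<tau>\<in>T. x \<in> A \<tau> - B \<tau>)" for x
    unfolding X_def Y_def using that by (intro sum.cong) (auto simp: indicator_def)
  have "{x. \<not> (\<exists>\<tau>\<in>T. x \<in> A \<tau> - B \<tau>)} \<subseteq> {x. (X x - \<mu>)\<^sup>2 \<ge> \<mu>\<^sup>2 / 4} \<union> {x. Y x \<ge> \<mu> / 2}"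
  proof
    fix x assume "x \<in> {x. \<not> (\<exists>\<tau>\<in>T. x \<in> A \<tau> - B \<tau>)}"
    hence eq: "X x = Y x" using XY by blast
    show "x \<in> {x. (X x - \<mu>)\<^sup>2 \<ge> \<mu>\<^sup>2 / 4} \<union> {x. Y x \<ge> \<mu> / 2}"
    proof (cases "X x \<ge> \<mu> / 2")
      case False
      hence "(\<mu> / 2)\<^sup>2 \<le> (\<mu> - X x)\<^sup>2" using \<mu>(2) by (intro power_mono) auto
      thus ?thesis by (simp add: power2_commute power_divide)
    qed (use eq in auto)
  qed
  hence "measure_pmf.prob M {x. \<not> (\<exists>\<tau>\<in>T. x \<in> A \<tau> - B \<tau>)} \<le>
      measure_pmf.prob M ({x. (X x - \<mu>)\<^sup>2 \<ge> \<mu>\<^sup>2 / 4} \<union> {x. Y x \<ge> \<mu> / 2})"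
    by (intro measure_pmf.finite_measure_mono) auto
  also have "\<dots> \<le> measure_pmf.prob M {x. (X x - \<mu>)\<^sup>2 \<ge> \<mu>\<^sup>2 / 4} + measure_pmf.prob M {x. Y x \<ge> \<mu> / 2}"
    by (intro measure_Un_le) auto
  also have "\<dots> \<le> ?E (\<lambda>x. (X x - \<mu>)\<^sup>2) / (\<mu>\<^sup>2 / 4) + ?E Y / (\<mu> / 2)"
    using \<mu>(2) fin by (intro add_mono pmf_markov) (auto simp: Y_def intro!: sum_nonneg)
  also have "\<dots> \<le> (\<mu> + (c - 1) * \<mu>\<^sup>2) / (\<mu>\<^sup>2 / 4) + (\<delta> * \<mu>) / (\<mu> / 2)"
    using Var EY \<mu>(2) by (intro add_mono divide_right_mono) auto
  also have "\<dots> = 4 * (1 / \<mu> + (c - 1)) + 2 * \<delta>"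
    using \<mu>(2) by (simp add: field_simps power2_eq_square)
  finally show ?thesis .
qed

section \<open>Probabilities of product events\<close>

definition all_steps :: "nat \<Rightarrow> (nat \<Rightarrow> nat set) \<Rightarrow> (nat \<Rightarrow> nat) set" where
  "all_steps n S = {i. \<forall>t<n. i t \<in> S t}"

lemma prob_all_steps:
  "measure_pmf.prob (choice_pmf k n) (all_steps n S) =
     (\<Prod>t<n. real (card ({..k * t} \<inter> S t)) / real (k * t + 1))"
proof -
  have "all_steps n S = Pi {..<n} S" by (auto simp: all_steps_def)
  thus ?thesis
    by (simp add: choice_pmf_def measure_Pi_pmf_Pi measure_pmf_of_set)
qed

text \<open>Independent uniform choices, conditioned on a product event, are independent and uniform
  on the smaller sets. Both laws are uniform on finite function sets, so this is a count.\<close>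

lemma prob_all_steps_conditional:
  assumes "\<And>t. t < n \<Longrightarrow> S t \<subseteq> {..k * t}" "\<And>t. t < n \<Longrightarrow> S t \<noteq> {}"
  shows "measure_pmf.prob (choice_pmf k n) (all_steps n S \<inter> B) =
     (\<Prod>t<n. real (card (S t)) / real (k * t + 1)) *
     measure_pmf.prob (Pi_pmf {..<n} 0 (\<lambda>t. pmf_of_set (S t))) B"
proof -
  let ?W = "PiE_dflt {..<n} 0 (\<lambda>t. {..k * t})" and ?W' = "PiE_dflt {..<n} 0 S"
  have finS: "finite (S t)" if "t < n" for t using assms(1)[OF that] finite_subset by blast
  have fin: "finite ?W" "finite ?W'" using finS by (auto intro!: finite_PiE_dflt)
  have ne: "?W \<noteq> {}" "?W' \<noteq> {}" using assms(2) by auto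
  have eq: "?W \<inter> (all_steps n S \<inter> B) = ?W' \<inter> B"
    using assms(1) by (fastforce simp: PiE_dflt_def all_steps_def)
  have c: "card ?W = (\<Prod>t<n. k * t + 1)" "card ?W' = (\<Prod>t<n. card (S t))"
    using card_PiE_dflt[of "{..<n}" S 0] finS by (simp_all add: card_PiE_dflt)
  have "card ?W' > 0" using fin ne by (simp add: card_gt_0_iff)
  have "measure_pmf.prob (choice_pmf k n) (all_steps n S \<inter> B) = card (?W' \<inter> B) / card ?W"
    unfolding choice_pmf_def using fin ne by (simp add: Pi_pmf_of_set measure_pmf_of_set eq)
  also have "\<dots> = (real (card ?W') / real (card ?W)) * (card (?W' \<inter> B) / card ?W')"
    using \<open>card ?W' > 0\<close> by simp
  also have "card (?W' \<inter> B) / card ?W' = measure_pmf.prob (Pi_pmf {..<n} 0 (\<lambda>t. pmf_of_set (S t))) B"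
    using fin ne finS assms(2) by (subst Pi_pmf_of_set) (auto simp: measure_pmf_of_set)
  also have "real (card ?W') / real (card ?W) = (\<Prod>t<n. real (card (S t)) / real (k * t + 1))"
    unfolding c by (simp add: prod_dividef)
  finally show ?thesis .
qed

text \<open>
  With disjoint windows, the chains of two distinct candidates that share a time exclude each other:
  otherwise one chain could continue the other.
\<close>
definition candidates :: "nat \<Rightarrow> nat \<Rightarrow> (nat \<Rightarrow> nat) set" where
  "candidates k m = PiE {..<k} (\<lambda>j. {Suc j * m..<Suc (Suc j) * m})"

definition chain_prob :: "nat \<Rightarrow> nat \<Rightarrow> (nat \<Rightarrow> nat) \<Rightarrow> real" where
  "chain_prob k n \<tau> = (\<Prod>t<n. real (card (chain_steps k \<tau> t)) / real (k * t + 1))"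

lemma card_candidates: "card (candidates k m) = m ^ k"
  by (simp add: candidates_def card_PiE)

lemma finite_candidates: "finite (candidates k m)"
  by (auto simp: candidates_def intro: finite_PiE)

lemma candidate_window:
  assumes "\<tau> \<in> candidates k m" "j < k"
  shows "Suc j * m \<le> \<tau> j" "\<tau> j < Suc (Suc j) * m"
proof -
  have "\<tau> j \<in> {Suc j * m..<Suc (Suc j) * m}"
    using assms unfolding candidates_def by (intro PiE_mem[of \<tau>]) auto
  thus "Suc j * m \<le> \<tau> j" "\<tau> j < Suc (Suc j) * m" by auto
qed

lemma candidate_mono:
  assumes "\<tau> \<in> candidates k m" "j < l" "l < k"
  shows "\<tau> j < \<tau> l"
proof -
  have "Suc (Suc j) * m \<le> Suc l * m" using assms(2) by (intro mult_right_mono) auto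
  with candidate_window[OF assms(1), of j] candidate_window[OF assms(1), of l] assms
  show ?thesis by simp
qed

lemma candidate_same_index:
  assumes "\<tau> \<in> candidates k m" "\<tau>' \<in> candidates k m" "j < k" "l < k" "\<tau> j = \<tau>' l"
  shows "j = l"
proof (rule ccontr)
  assume "j \<noteq> l"
  then consider "Suc (Suc j) \<le> Suc l" | "Suc (Suc l) \<le> Suc j" by linarith
  thus False
  proof cases
    case 1
    hence "Suc (Suc j) * m \<le> Suc l * m" by (rule mult_right_mono) simp
    with candidate_window[OF assms(1,3)] candidate_window[OF assms(2,4)] assms(5) show False by linarith
  next
    case 2
    hence "Suc (Suc l) * m \<le> Suc j * m" by (rule mult_right_mono) simp
    with candidate_window[OF assms(1,3)] candidate_window[OF assms(2,4)] assms(5) show False by linarith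
  qed
qed

lemma candidate_less:
  assumes "\<tau> \<in> candidates k m" "j < k"
  shows "m \<le> \<tau> j" "\<tau> j < Suc k * m"
proof -
  have "Suc (Suc j) * m \<le> Suc k * m" using assms(2) by (intro mult_right_mono) auto
  with candidate_window[OF assms] show "\<tau> j < Suc k * m" by linarith
  show "m \<le> \<tau> j" using candidate_window[OF assms] by simp
qed

section \<open>Admissible steps and probabilities of chains\<close>

lemma finite_forbidden: "finite (forbidden k \<tau>)"
  by (simp add: forbidden_def)

lemma card_forbidden:
  assumes "k > 0"
  shows "card (forbidden k \<tau>) \<le> k\<^sup>2 - 1"
proof -
  let ?I = "(\<lambda>(j, r). k * \<tau> j + 1 + r) ` ({..<k} \<times> {..<k})"
  have "card ?I \<le> card ({..<k} \<times> {..<k})" by (rule card_image_le) simp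
  hence "card ?I \<le> k\<^sup>2" by (simp add: power2_eq_square)
  moreover have "k * \<tau> (k - 1) + 1 \<in> ?I"
    using assms by (auto intro!: image_eqI[of _ _ "(k - 1, 0)"])
  hence "card (forbidden k \<tau>) = card ?I - 1" unfolding forbidden_def by (rule card_Diff_singleton)
  ultimately show ?thesis by linarith
qed

lemma forbiddenE:
  assumes "x \<in> forbidden k \<tau>"
  obtains j r where "j < k" "r < k" "x = k * \<tau> j + 1 + r"
  using assms by (auto simp: forbidden_def)

lemma chain_steps_subset:
  assumes "\<tau> \<in> candidates k m"
  shows "chain_steps k \<tau> t \<subseteq> {..k * t}"
proof
  fix x assume x: "x \<in> chain_steps k \<tau> t"
  show "x \<in> {..k * t}"
  proof (cases "t \<in> \<tau> ` {1..<k}")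
    case True
    with x obtain j where j: "x = k * \<tau> j + 1" "Suc j < k" "\<tau> (Suc j) = t"
      by (auto simp: chain_steps_def)
    with candidate_mono[OF assms, of j "Suc j"] have "Suc (\<tau> j) \<le> t" by simp
    hence "k * Suc (\<tau> j) \<le> k * t" by (rule mult_left_mono) simp
    with j show ?thesis by simp
  qed (use x in \<open>auto simp: chain_steps_def\<close>)
qed

lemma chain_steps_pick:
  assumes "\<tau> \<in> candidates k m" "Suc j < k"
  shows "chain_steps k \<tau> (\<tau> (Suc j)) = {k * \<tau> j + 1}"
proof -
  have "\<tau> (Suc j) \<in> \<tau> ` {1..<k}" using assms by auto
  moreover have "j' = j" if "Suc j' < k" "\<tau> (Suc j') = \<tau> (Suc j)" for j'
    using candidate_same_index[OF assms(1,1) that(1) assms(2) that(2)] by simp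
  ultimately show ?thesis using assms(2) by (auto simp: chain_steps_def)
qed

lemma card_chain_steps_other:
  assumes "k > 0" "t \<notin> \<tau> ` {1..<k}"
  shows "card (chain_steps k \<tau> t) \<ge> k * t + 1 - (k\<^sup>2 - 1)"
proof -
  have "card {..k * t} - card (forbidden k \<tau>) \<le> card ({..k * t} - forbidden k \<tau>)"
    by (rule diff_card_le_card_Diff[OF finite_forbidden])
  with card_forbidden[OF assms(1), of \<tau>] assms(2) show ?thesis by (simp add: chain_steps_def)
qed

text \<open>All chain times are at least \<open>m\<close>, so before \<open>m\<close> no forbidden
  clique exists yet.\<close>

lemma chain_steps_full:
  assumes "\<tau> \<in> candidates k m" "t < m"
  shows "chain_steps k \<tau> t = {..k * t}"
proof -
  have "t \<notin> \<tau> ` {1..<k}" using candidate_less[OF assms(1)] assms(2) by fastforce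
  moreover have "x > k * t" if "x \<in> forbidden k \<tau>" for x
  proof -
    from that obtain j r where "j < k" "x = k * \<tau> j + 1 + r" by (rule forbiddenE)
    moreover from this have "k * t \<le> k * \<tau> j"
      using candidate_less[OF assms(1), of j] assms(2) by (intro mult_left_mono) auto
    ultimately show ?thesis by linarith
  qed
  ultimately show ?thesis by (fastforce simp: chain_steps_def)
qed

text \<open>Makes the uniform laws on admissible steps meaningful. From time
  \<open>m \<ge> k\<close> on there are at least k^2 + 1 cliques and at most k^2 - 1 of them are
  forbidden.\<close>

lemma chain_steps_nonempty:
  assumes "\<tau> \<in> candidates k m" "k > 0" "m \<ge> k"
  shows "chain_steps k \<tau> t \<noteq> {}"
proof (cases "t \<in> \<tau> ` {1..<k}")
  case True
  then obtain l where "l \<in> {1..<k}" "t = \<tau> l" by auto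
  with chain_steps_pick[OF assms(1), of "l - 1"] show ?thesis by simp
next
  case False
  show ?thesis
  proof (cases "t < m")
    case True
    with chain_steps_full[OF assms(1)] show ?thesis by auto
  next
    case f: False
    hence "k * k \<le> k * t" using assms by (intro mult_left_mono) auto
    hence "card (chain_steps k \<tau> t) > 0"
      using card_chain_steps_other[OF assms(2) False] unfolding power2_eq_square by linarith
    thus ?thesis by auto
  qed
qed

lemma prob_chain:
  assumes "\<tau> \<in> candidates k m"
  shows "measure_pmf.prob (choice_pmf k n) (all_steps n (chain_steps k \<tau>)) = chain_prob k n \<tau>"
  using chain_steps_subset[OF assms]
  by (simp add: prob_all_steps chain_prob_def Int_absorb1)

lemma barrier_chain_candidate:
  assumes "k \<ge> 2" "\<tau> \<in> candidates k m" "Suc k * m \<le> n" "i \<in> choices k"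
    "i \<in> all_steps n (chain_steps k \<tau>)"
  shows "barrier_chain k n \<tau> i"
proof
  show "\<tau> j < n" if "j < k" for j using candidate_less[OF assms(2) that] assms(3) by simp
qed (use assms candidate_mono in \<open>auto simp: all_steps_def\<close>)

text \<open>A common time propagates in both directions. Downwards, the clique picked at a chain
  time determines the previous chain time. Upwards, the pick at \<open>\<tau> (Suc l)\<close> is a
  mixed clique of the other chain, so that chain allows it only at one of its own times, and the
  windows force this to be \<open>\<tau>' (Suc l)\<close>.\<close>

lemma chains_overlap:
  assumes "k \<ge> 2" "Suc k * m \<le> n" "i \<in> choices k"
    and \<tau>: "\<tau> \<in> candidates k m" "i \<in> all_steps n (chain_steps k \<tau>)"
    and \<tau>': "\<tau>' \<in> candidates k m" "i \<in> all_steps n (chain_steps k \<tau>')"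
    and j: "j < k" "\<tau> j = \<tau>' j"
  shows "\<tau> = \<tau>'"
proof -
  interpret A: barrier_chain k n \<tau> i by (rule barrier_chain_candidate) fact+
  interpret B: barrier_chain k n \<tau>' i by (rule barrier_chain_candidate) fact+
  have down: "\<tau> l = \<tau>' l" if "\<tau> (Suc l) = \<tau>' (Suc l)" "Suc l < k" for l
    using A.pick[OF that(2)] B.pick[OF that(2)] that A.k0 by simp
  have up: "\<tau> (Suc l) = \<tau>' (Suc l)" if eq: "\<tau> l = \<tau>' l" and l: "Suc l < k" for l
  proof -
    \<comment> \<open>Since \<open>l < k - 1\<close>, the picked index is not the end clique
      exempted in \<open>forbidden\<close>.\<close>
    have "\<tau>' l \<noteq> \<tau>' (k - 1)" using B.inj[of l "k - 1"] l by auto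
    hence "k * \<tau>' l + 1 \<noteq> k * \<tau>' (k - 1) + 1" using A.k0 by simp
    hence "i (\<tau> (Suc l)) \<in> forbidden k \<tau>'"
      using A.pick[OF l] eq l unfolding forbidden_def
      by (auto intro!: image_eqI[of _ _ "(l, 0)"])
    hence "\<tau> (Suc l) \<in> \<tau>' ` {1..<k}" using B.avoid[OF A.bound[OF l]] by blast
    then obtain l' where "l' < k" "\<tau> (Suc l) = \<tau>' l'" by auto
    with candidate_same_index[OF \<tau>(1) \<tau>'(1) l, of l'] show ?thesis by simp
  qed
  have 0: "\<tau> 0 = \<tau>' 0"
    using j by (induction j) (use down in auto)
  have "\<tau> l = \<tau>' l" if "l < k" for l
    using that by (induction l) (use 0 up in auto)
  thus ?thesis using \<tau>(1) \<tau>'(1) unfolding candidates_def by (auto intro: PiE_ext)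
qed

text \<open>At a chain time of \<open>\<tau>\<close> the second chain merely avoids its forbidden
  cliques. Its factor is at least 1 - k / m because \<open>t \<ge> m\<close>, so the joint factor is
  bounded by the product at the cost of m / (m - k).\<close>

lemma step_pair_bound:
  assumes k: "k > 0" and m: "m > k"
    and \<tau>: "\<tau> \<in> candidates k m" and \<tau>': "\<tau>' \<in> candidates k m"
    and disj: "\<And>j l. j < k \<Longrightarrow> l < k \<Longrightarrow> \<tau> j \<noteq> \<tau>' l"
    and t: "t = \<tau> (Suc j)" "Suc j < k"
  shows "real (card (chain_steps k \<tau> t \<inter> chain_steps k \<tau>' t)) / real (k * t + 1)
    \<le> real (card (chain_steps k \<tau> t)) / real (k * t + 1) *
      (real (card (chain_steps k \<tau>' t)) / real (k * t + 1)) * (real m / real (m - k))"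
proof -
  have S: "chain_steps k \<tau> t = {k * \<tau> j + 1}" using chain_steps_pick[OF \<tau> t(2)] t(1) by simp
  have tm: "m \<le> t" using candidate_less[OF \<tau> t(2)] t(1) by simp
  have "t \<notin> \<tau>' ` {1..<k}"
  proof
    assume "t \<in> \<tau>' ` {1..<k}"
    then obtain l where "l < k" "\<tau>' l = t" by auto
    with disj[OF t(2), of l] t(1) show False by simp
  qed
  from card_chain_steps_other[OF k this]
  have "real (card (chain_steps k \<tau>' t)) \<ge> real (k * t + 1) - real (k\<^sup>2)" by linarith
  moreover have N: "real (k * t + 1) \<noteq> 0" unfolding of_nat_eq_0_iff by simp
  ultimately have "(real (k * t + 1) - real (k\<^sup>2)) / real (k * t + 1)
      \<le> real (card (chain_steps k \<tau>' t)) / real (k * t + 1)"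
    by (intro divide_right_mono) auto
  moreover have "(real (k * t + 1) - real (k\<^sup>2)) / real (k * t + 1) = 1 - real (k\<^sup>2) / real (k * t + 1)"
    by (simp only: diff_divide_distrib divide_self[OF N])
  ultimately have lo: "real (card (chain_steps k \<tau>' t)) / real (k * t + 1) \<ge> 1 - real (k\<^sup>2) / real (k * t + 1)"
    by linarith
  have "k * m \<le> k * t" using tm by (intro mult_left_mono) auto
  hence "real (k * m) \<le> real (k * t + 1)" by (simp only: of_nat_le_iff)
  hence "real (k\<^sup>2) / real (k * t + 1) \<le> real (k\<^sup>2) / real (k * m)"
    by (rule frac_le[OF _ order_refl, rotated 2]) (use k m in simp_all)
  also have "\<dots> = real k / real m" using k by (simp add: power2_eq_square)
  finally have "real (card (chain_steps k \<tau>' t)) / real (k * t + 1) \<ge> real (m - k) / real m"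
    using lo m by (simp add: diff_divide_distrib of_nat_diff)
  hence "real (card (chain_steps k \<tau>' t)) / real (k * t + 1) * (real m / real (m - k))
      \<ge> real (m - k) / real m * (real m / real (m - k))"
    by (rule mult_right_mono) simp
  hence ge1: "real (card (chain_steps k \<tau>' t)) / real (k * t + 1) * (real m / real (m - k)) \<ge> 1"
    using m by simp
  have "card (chain_steps k \<tau> t \<inter> chain_steps k \<tau>' t) \<le> card (chain_steps k \<tau> t)"
    unfolding S by (intro card_mono) auto
  hence "real (card (chain_steps k \<tau> t \<inter> chain_steps k \<tau>' t)) / real (k * t + 1)
      \<le> real (card (chain_steps k \<tau> t)) / real (k * t + 1) * 1"
    by (simp add: divide_right_mono)
  also have "\<dots> \<le> real (card (chain_steps k \<tau> t)) / real (k * t + 1) *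
      (real (card (chain_steps k \<tau>' t)) / real (k * t + 1) * (real m / real (m - k)))"
    by (rule mult_left_mono[OF ge1]) simp
  finally show ?thesis by (simp add: mult_ac)
qed

text \<open>Avoiding two disjoint sets is negatively correlated for a uniform choice: with
  \<open>a\<close>, \<open>b\<close>, \<open>c\<close> the sizes of the two sets within
  \<open>A\<close> and of the rest, c (a + b + c) is at most (b + c) (a + c).\<close>

lemma card_Diff_disjoint_pair:
  assumes "finite A" "F \<inter> F' = {}"
  shows "card (A - F - F') * card A \<le> card (A - F) * card (A - F')"
proof -
  define a where "a = card (A \<inter> F)"
  define b where "b = card (A \<inter> F')"
  have 1: "card (A - F) = card A - a" "card (A - F') = card A - b"
    using assms(1) by (simp_all add: card_Diff_subset_Int a_def b_def)
  have ab: "card ((A \<inter> F) \<union> (A \<inter> F')) = a + b"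
    unfolding a_def b_def using assms by (intro card_Un_disjoint) auto
  have "card (A - F - F') = card (A - ((A \<inter> F) \<union> (A \<inter> F')))"
    by (rule arg_cong[of _ _ card]) blast
  also have "\<dots> = card A - card ((A \<inter> F) \<union> (A \<inter> F'))"
    using assms(1) by (intro card_Diff_subset) auto
  finally have 2: "card (A - F - F') = card A - (a + b)" unfolding ab .
  have "card ((A \<inter> F) \<union> (A \<inter> F')) \<le> card A" using assms(1) by (intro card_mono) auto
  hence "a + b \<le> card A" using ab by simp
  then obtain c where c: "card A = a + b + c" by (metis le_iff_add)
  show ?thesis unfolding 1 2 c by (simp add: algebra_simps)
qed

text \<open>Factor by factor comparison. Forbidden sets of chains without a common time are
  disjoint, so steps that are chain times of neither candidate are negatively correlated; each of
  the fewer than \<open>2 * k\<close> remaining steps costs one factor \<rho>.\<close>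

lemma prob_chain_pair:
  assumes k: "k > 0" and m: "m > k"
    and \<tau>: "\<tau> \<in> candidates k m" and \<tau>': "\<tau>' \<in> candidates k m"
    and disj: "\<And>j l. j < k \<Longrightarrow> l < k \<Longrightarrow> \<tau> j \<noteq> \<tau>' l"
  shows "measure_pmf.prob (choice_pmf k n)
           (all_steps n (chain_steps k \<tau>) \<inter> all_steps n (chain_steps k \<tau>'))
    \<le> (real m / real (m - k)) ^ (2 * k) * (chain_prob k n \<tau> * chain_prob k n \<tau>')"
proof -
  define \<rho> where "\<rho> = real m / real (m - k)"
  define Z where "Z = \<tau> ` {1..<k} \<union> \<tau>' ` {1..<k}"
  define S where "S t = chain_steps k \<tau> t" for t
  define S' where "S' t = chain_steps k \<tau>' t" for t
  have \<rho>1: "\<rho> \<ge> 1" using m by (simp add: \<rho>_def)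
  have finZ: "finite Z" by (simp add: Z_def)
  have FF: "forbidden k \<tau> \<inter> forbidden k \<tau>' = {}"
  proof (rule ccontr)
    assume "forbidden k \<tau> \<inter> forbidden k \<tau>' \<noteq> {}"
    then obtain x where "x \<in> forbidden k \<tau>" "x \<in> forbidden k \<tau>'" by auto
    then obtain j r j' r' where "j < k" "r < k" "x = k * \<tau> j + 1 + r"
      "j' < k" "r' < k" "x = k * \<tau>' j' + 1 + r'" by (metis forbiddenE)
    with clique_index_inj[of k "\<tau> j" r "\<tau>' j'" r'] disj show False by metis
  qed
  have step: "real (card (S t \<inter> S' t)) / real (k * t + 1) \<le>
     real (card (S t)) / real (k * t + 1) * (real (card (S' t)) / real (k * t + 1)) *
     (if t \<in> Z then \<rho> else 1)" for t
  proof -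
    consider j where "t = \<tau> (Suc j)" "Suc j < k" | j where "t = \<tau>' (Suc j)" "Suc j < k" | "t \<notin> Z"
    proof (cases "t \<in> Z")
      case True
      then obtain l where "l \<ge> 1" "l < k" "t = \<tau> l \<or> t = \<tau>' l" by (auto simp: Z_def)
      with that(1,2)[of "l - 1"] show ?thesis by auto
    qed (use that(3) in auto)
    thus ?thesis
    proof cases
      case 1
      hence "t \<in> Z" by (auto simp: Z_def)
      with step_pair_bound[OF k m \<tau> \<tau>' disj 1] show ?thesis by (simp add: S_def S'_def \<rho>_def)
    next
      case 2
      hence "t \<in> Z" by (auto simp: Z_def)
      moreover have "\<tau>' j \<noteq> \<tau> l" if "j < k" "l < k" for j l using disj[OF that(2,1)] by simp
      ultimately show ?thesis
        using step_pair_bound[OF k m \<tau>' \<tau> _ 2] by (simp add: S_def S'_def \<rho>_def Int_commute mult_ac)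
    next
      case 3
      hence eq: "S t = {..k * t} - forbidden k \<tau>" "S' t = {..k * t} - forbidden k \<tau>'"
        by (auto simp: S_def S'_def chain_steps_def Z_def)
      have "S t \<inter> S' t = {..k * t} - forbidden k \<tau> - forbidden k \<tau>'" unfolding eq by blast
      with card_Diff_disjoint_pair[OF _ FF, of "{..k * t}"] eq
      have "card (S t \<inter> S' t) * (k * t + 1) \<le> card (S t) * card (S' t)" by simp
      hence "real (card (S t \<inter> S' t)) * real (k * t + 1) \<le> real (card (S t)) * real (card (S' t))"
        by (metis of_nat_le_iff of_nat_mult)
      with 3 show ?thesis by (simp add: divide_simps)
    qed
  qed
  have "all_steps n (chain_steps k \<tau>) \<inter> all_steps n (chain_steps k \<tau>') = all_steps n (\<lambda>t. S t \<inter> S' t)"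
    by (auto simp: all_steps_def S_def S'_def)
  moreover have "{..k * t} \<inter> (S t \<inter> S' t) = S t \<inter> S' t" for t
    using chain_steps_subset[OF \<tau>] by (auto simp: S_def)
  ultimately have "measure_pmf.prob (choice_pmf k n)
           (all_steps n (chain_steps k \<tau>) \<inter> all_steps n (chain_steps k \<tau>'))
      = (\<Prod>t<n. real (card (S t \<inter> S' t)) / real (k * t + 1))"
    by (simp add: prob_all_steps)
  also have "\<dots> \<le> (\<Prod>t<n. real (card (S t)) / real (k * t + 1) * (real (card (S' t)) / real (k * t + 1)) *
     (if t \<in> Z then \<rho> else 1))"
    by (intro prod_mono conjI step) auto
  also have "\<dots> = chain_prob k n \<tau> * chain_prob k n \<tau>' * (\<Prod>t<n. if t \<in> Z then \<rho> else 1)"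
    by (simp only: prod.distrib chain_prob_def S_def S'_def)
  also have "(\<Prod>t<n. if t \<in> Z then \<rho> else 1) = \<rho> ^ card ({..<n} \<inter> Z)"
    by (simp add: prod.If_cases)
  also have "chain_prob k n \<tau> * chain_prob k n \<tau>' * \<dots> \<le> chain_prob k n \<tau> * chain_prob k n \<tau>' * \<rho> ^ (2 * k)"
  proof (intro mult_left_mono power_increasing[OF _ \<rho>1])
    have "card ({..<n} \<inter> Z) \<le> card Z" using finZ by (intro card_mono) auto
    also have "\<dots> \<le> card (\<tau> ` {1..<k}) + card (\<tau>' ` {1..<k})" unfolding Z_def by (rule card_Un_le)
    also have "\<dots> \<le> card {1..<k} + card {1..<k}" by (intro add_mono card_image_le) auto
    finally show "card ({..<n} \<inter> Z) \<le> 2 * k" by simp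
  qed (simp add: chain_prob_def prod_nonneg)
  finally have "measure_pmf.prob (choice_pmf k n)
           (all_steps n (chain_steps k \<tau>) \<inter> all_steps n (chain_steps k \<tau>'))
    \<le> chain_prob k n \<tau> * chain_prob k n \<tau>' * \<rho> ^ (2 * k)" .
  thus ?thesis unfolding \<rho>_def by (simp only: mult.commute)
qed

subsection \<open>Degrees\<close>

text \<open>
  After \<open>p\<close> picks at least \<open>1 + (k - 1) p\<close> of the admissible cliques contain the vertex. The factors are chosen
  such that a pick with probability at least \<open>(1 + (k - 1) p) / N\<close> multiplies the expected potential by at most
  \<open>1 - 1 / (2 N)\<close>, whatever \<open>p\<close> is.
\<close>
definition urn_potential :: "nat \<Rightarrow> nat \<Rightarrow> real" where
  "urn_potential k p = (\<Prod>i<p. 1 - 1 / (2 * (1 + (real k - 1) * real i)))"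

lemma urn_potential_Suc:
  "urn_potential k (Suc p) = urn_potential k p * (1 - 1 / (2 * (1 + (real k - 1) * real p)))"
  by (simp add: urn_potential_def)

lemma urn_factor:
  assumes "k \<ge> 1"
  shows "1 - 1 / (2 * (1 + (real k - 1) * real i)) \<ge> 1 / 2"
        "1 - 1 / (2 * (1 + (real k - 1) * real i)) \<le> 1"
proof -
  have *: "(real k - 1) * real i \<ge> 0" using assms by simp
  hence "1 / (2 * (1 + (real k - 1) * real i)) \<le> 1 / (2 * (1 + 0))"
    by (intro divide_left_mono) (auto intro: add_pos_nonneg)
  thus "1 - 1 / (2 * (1 + (real k - 1) * real i)) \<ge> 1 / 2" by simp
  show "1 - 1 / (2 * (1 + (real k - 1) * real i)) \<le> 1" using * by simp
qed

lemma urn_potential_pos: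
  assumes "k \<ge> 1"
  shows "urn_potential k p > 0"
  unfolding urn_potential_def
proof (rule prod_pos)
  fix i show "1 - 1 / (2 * (1 + (real k - 1) * real i)) > 0"
    using urn_factor(1)[OF assms, of i] by linarith
qed

lemma urn_potential_antimono:
  assumes "k \<ge> 1" "p \<le> q"
  shows "urn_potential k q \<le> urn_potential k p"
  using assms(2)
proof (induction q rule: dec_induct)
  case (step q)
  have "urn_potential k (Suc q) \<le> urn_potential k q * 1"
    unfolding urn_potential_Suc
    using urn_factor(2)[OF assms(1)] urn_potential_pos[OF assms(1)]
    by (intro mult_left_mono) (auto intro: less_imp_le)
  with step show ?case by simp
qed simp

text \<open>The potential decays at most like the power -\<theta> of \<open>p\<close>. The factor
  for \<open>i = 0\<close> equals 1/2 and is split off, hence \<open>Suc p\<close>; the later ones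
  are compared with a telescoping product.\<close>

lemma urn_potential_lower:
  assumes k: "k \<ge> 2"
  defines "\<theta> \<equiv> 1 / (2 * (real k - 1))"
  shows "urn_potential k (Suc p) \<ge> 1 / 2 * (\<theta> / (real p + \<theta>)) powr \<theta>"
proof (induction p)
  case 0
  have "\<theta> > 0" using k by (simp add: \<theta>_def)
  thus ?case by (simp add: urn_potential_def)
next
  case (Suc p)
  have \<theta>: "\<theta> > 0" using k by (simp add: \<theta>_def)
  define x where "x = real p + 1 + \<theta>"
  have x: "x > 1" using \<theta> by (simp add: x_def)
  have k': "(real k - 1) * (2 * \<theta>) = 1" using k by (simp add: \<theta>_def)
  have "2 * (1 + (real k - 1) * real (Suc p)) = 2 * (real k - 1) * (x + \<theta>)"
    using k' by (simp add: x_def algebra_simps)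
  hence "1 - 1 / (2 * (1 + (real k - 1) * real (Suc p))) = 1 - \<theta> / (x + \<theta>)"
    using k by (simp add: \<theta>_def)
  also have "\<dots> = 1 / (1 + \<theta> / x)"
    using x \<theta> by (simp add: divide_simps)
  \<comment> \<open>Two exponential estimates: 1 + \<theta> / x is at most exp (1 / x) to the power
    \<theta>, and exp (1 / x) is at most x / (x - 1).\<close>
  also have "\<dots> \<ge> ((x - 1) / x) powr \<theta>"
  proof -
    have "1 + \<theta> / x \<le> exp (\<theta> / x)" by (rule exp_ge_add_one_self)
    also have "\<dots> = exp (1 / x) powr \<theta>" by (simp add: exp_powr_real)
    also have "\<dots> \<le> (x / (x - 1)) powr \<theta>"
    proof (rule powr_mono2)
      have "1 + - 1 / x \<le> exp (- 1 / x)" by (rule exp_ge_add_one_self)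
      hence "(x - 1) / x \<le> exp (- (1 / x))" using x by (simp add: diff_divide_distrib)
      hence "inverse (exp (- (1 / x))) \<le> inverse ((x - 1) / x)"
        using x by (intro le_imp_inverse_le) auto
      thus "exp (1 / x) \<le> x / (x - 1)" by (simp add: exp_minus)
    qed (use \<theta> in auto)
    finally have "1 / (x / (x - 1)) powr \<theta> \<le> 1 / (1 + \<theta> / x)"
      using x \<theta> by (intro divide_left_mono) (auto intro!: mult_pos_pos add_pos_pos)
    moreover have "1 / (x / (x - 1)) powr \<theta> = ((x - 1) / x) powr \<theta>"
      using x by (simp add: powr_divide)
    ultimately show ?thesis by simp
  qed
  finally have fac: "((x - 1) / x) powr \<theta> \<le> 1 - 1 / (2 * (1 + (real k - 1) * real (Suc p)))" .
  have "1 / 2 * (\<theta> / (real (Suc p) + \<theta>)) powr \<theta>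
      = 1 / 2 * (\<theta> / (real p + \<theta>)) powr \<theta> * ((x - 1) / x) powr \<theta>"
    using \<theta> by (simp add: powr_mult[symmetric] x_def add_ac)
  also have "\<dots> \<le> urn_potential k (Suc p) * (1 - 1 / (2 * (1 + (real k - 1) * real (Suc p))))"
    using Suc.IH fac urn_potential_pos[of k "Suc p"] k by (intro mult_mono) auto
  finally show ?case by (simp only: urn_potential_Suc[of k "Suc p"])
qed

text \<open>Besides \<open>q\<close>, each pick of a clique containing \<open>v\<close> creates
  \<open>k\<close> cliques, and only the one in which \<open>v\<close> itself is replaced loses it.
  Cliques created from time \<open>M\<close> on have index above \<open>k * M\<close>, so they
  differ from \<open>q\<close> and lie outside \<open>F\<close>.\<close>

lemma card_cliques_containing:
  assumes k: "k > 0" and i: "i \<in> choices k"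
    and q: "q \<le> k * M" "v \<in> set (ktree_clique k i q)" and F: "F \<subseteq> {..k * M}" "q \<notin> F"
    and "M \<le> n"
  shows "1 + (k - 1) * picks k i v M n
    \<le> card {x \<in> {..k * n} - F. v \<in> set (ktree_clique k i x)}"
proof -
  define T where "T = {t \<in> {M..<n}. v \<in> set (ktree_clique k i (i t))}"
  define R where "R t = {r. r < k \<and> v \<in> set (ktree_clique k i (k * t + 1 + r))}" for t
  define h where "h = (\<lambda>(t, r). k * t + 1 + r)"
  have R: "card (R t) \<ge> k - 1" if t: "t \<in> T" for t
  proof -
    from t obtain l where l: "l < k" "ktree_clique k i (i t) ! l = v"
      using ktree_clique_length[OF i k] by (auto simp: T_def in_set_conv_nth)
    have "{..<k} - {l} \<subseteq> R t"
    proof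
      fix r assume r: "r \<in> {..<k} - {l}"
      hence "ktree_clique k i (i t) ! r \<noteq> v"
        using l ktree_clique_distinct[OF i k] ktree_clique_length[OF i k]
        by (auto simp: nth_eq_iff_index_eq)
      with r t show "r \<in> R t"
        using set_ktree_clique_step[OF i, of r t] by (auto simp: R_def T_def)
    qed
    moreover have "finite (R t)" by (simp add: R_def)
    ultimately have "card ({..<k} - {l}) \<le> card (R t)" by (rule card_mono[rotated])
    with l show ?thesis by simp
  qed
  have big: "k * M < h (t, r)" if "t \<in> T" for t r
  proof -
    have "k * M \<le> k * t" using that by (intro mult_left_mono) (auto simp: T_def)
    hence "k * M < k * t + 1 + r" by linarith
    thus ?thesis by (simp add: h_def)
  qed
  have small: "h (t, r) \<le> k * n" if "t \<in> T" "r \<in> R t" for t r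
  proof -
    have "k * Suc t \<le> k * n" using that by (intro mult_left_mono) (auto simp: T_def)
    with that show ?thesis by (auto simp: h_def R_def)
  qed
  have "inj_on h (Sigma T R)"
  proof (rule inj_onI, clarify)
    fix t r t' r' assume a: "h (t, r) = h (t', r')" "r \<in> R t" "r' \<in> R t'"
    thus "t = t' \<and> r = r'"
      using clique_index_inj[of k t r t' r'] by (auto simp: h_def R_def)
  qed
  hence "card (h ` Sigma T R) = (\<Sum>t\<in>T. card (R t))"
    by (simp add: card_image R_def T_def)
  also have "\<dots> \<ge> (\<Sum>t\<in>T. k - 1)" using R by (rule sum_mono)
  finally have "card (h ` Sigma T R) \<ge> (k - 1) * picks k i v M n"
    by (simp add: picks_def T_def mult.commute)
  moreover have "q \<notin> h ` Sigma T R" using big q(1) by (fastforce simp: not_less[symmetric])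
  moreover have "finite (h ` Sigma T R)" by (simp add: T_def R_def)
  ultimately have "1 + (k - 1) * picks k i v M n \<le> card (insert q (h ` Sigma T R))" by simp
  also have "\<dots> \<le> card {x \<in> {..k * n} - F. v \<in> set (ktree_clique k i x)}"
  proof (rule card_mono)
    have "q \<le> k * n" using q(1) assms(7) by (meson le_trans mult_le_mono2)
    hence "q \<in> {x \<in> {..k * n} - F. v \<in> set (ktree_clique k i x)}" using q F by simp
    moreover have "h (t, r) \<in> {x \<in> {..k * n} - F. v \<in> set (ktree_clique k i x)}"
      if "t \<in> T" "r \<in> R t" for t r
    proof -
      have "h (t, r) \<notin> F" using big[OF that(1), of r] F(1) by auto
      moreover have "v \<in> set (ktree_clique k i (h (t, r)))" using that by (simp add: R_def h_def)
      ultimately show ?thesis using small[OF that] by blast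
    qed
    ultimately show "insert q (h ` Sigma T R) \<subseteq> {x \<in> {..k * n} - F. v \<in> set (ktree_clique k i x)}"
      by (intro insert_subsetI image_subsetI) auto
  qed simp
  finally show ?thesis .
qed

lemma picks_upd:
  assumes "k > 0" "i \<in> choices k" "x \<le> k * n" "M \<le> n"
  shows "picks k (i(n := x)) v M (Suc n) =
    picks k i v M n + (if v \<in> set (ktree_clique k i x) then 1 else 0)"
proof -
  have i': "i(n := x) \<in> choices k" using assms by (auto simp: choices_def)
  have eq: "ktree_clique k (i(n := x)) q = ktree_clique k i q" if "q \<le> k * n" for q
    using ktree_clique_cong[OF i' assms(2,1) _ that] by simp
  have le: "i t \<le> k * n" if "t < n" for t
    using choicesD[OF assms(2), of t] that by (meson le_trans less_imp_le mult_le_mono2)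
  have "{t \<in> {M..<Suc n}. v \<in> set (ktree_clique k (i(n := x)) ((i(n := x)) t))} =
      {t \<in> {M..<n}. v \<in> set (ktree_clique k i (i t))} \<union>
      (if v \<in> set (ktree_clique k i x) then {n} else {})"
    using assms(3,4) eq le by (auto simp: less_Suc_eq split: if_splits)
  thus ?thesis by (simp add: picks_def card_Un_disjoint)
qed

lemma pmf_of_set_expectation_two_valued:
  fixes a b :: real
  assumes "finite S" "S \<noteq> {}"
  shows "measure_pmf.expectation (pmf_of_set S) (\<lambda>x. if P x then a else b) =
     b - (b - a) * (real (card {x\<in>S. P x}) / real (card S))"
proof -
  have "(\<Sum>x\<in>S. if P x then a else b) = (\<Sum>x\<in>S. b - (b - a) * (if P x then 1 else 0))"
    by (intro sum.cong) auto
  also have "\<dots> = real (card S) * b - (b - a) * real (card {x\<in>S. P x})"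
    using assms(1) by (simp add: sum_subtractf sum_distrib_left[symmetric] sum.If_cases Int_def)
  finally show ?thesis
    using assms by (simp add: integral_pmf_of_set diff_divide_distrib)
qed

text \<open>The supermartingale argument, by averaging over the last step. The observed vertex may
  be random, but \<open>v_cong\<close> says that it is fixed by the steps before \<open>M\<close>,
  so it does not change during the induction. What \<open>S\<close> is before \<open>M\<close>
  matters only through the clique provided by \<open>v\<close>.\<close>

lemma expected_potential:
  fixes S :: "nat \<Rightarrow> nat set" and v :: "(nat \<Rightarrow> nat) \<Rightarrow> nat"
  defines "Q \<equiv> \<lambda>n. Pi_pmf {..<n} 0 (\<lambda>t. pmf_of_set (S t))"
  assumes k: "k \<ge> 2" and S: "\<And>t. S t \<subseteq> {..k * t}" "\<And>t. S t \<noteq> {}"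
    and SF: "\<And>t. t \<ge> M \<Longrightarrow> S t = {..k * t} - F" and F: "F \<subseteq> {..k * M}"
    and v: "\<And>i. i \<in> choices k \<Longrightarrow> i \<in> all_steps M S \<Longrightarrow>
       \<exists>q \<le> k * M. q \<notin> F \<and> v i \<in> set (ktree_clique k i q)"
    and v_cong: "\<And>i i'. i \<in> choices k \<Longrightarrow> i' \<in> choices k \<Longrightarrow> (\<And>t. t < M \<Longrightarrow> i t = i' t) \<Longrightarrow> v i = v i'"
    and "M \<le> n"
  shows "measure_pmf.expectation (Q n) (\<lambda>i. urn_potential k (picks k i (v i) M n))
     \<le> (\<Prod>t\<in>{M..<n}. 1 - 1 / (2 * (real k * real t + 1)))"
  using \<open>M \<le> n\<close>
proof (induction n rule: dec_induct)
  case base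
  show ?case by (simp add: picks_def urn_potential_def)
next
  case (step n)
  have finS: "finite (S t)" for t using S(1) finite_subset by blast
  have setQ: "set_pmf (Q n) = PiE_dflt {..<n} 0 S" for n
    unfolding Q_def using finS S(2) by (subst set_Pi_pmf) (auto simp: o_def set_pmf_of_set)
  have finQ: "finite (set_pmf (Q n))" for n
    unfolding setQ using finS by auto
  have bd: "1 - 1 / (2 * (real k * real n + 1)) \<ge> 0"
    using k by (auto simp: divide_simps add_nonneg_pos)
  \<comment> \<open>The newest choice is moved behind the first \<open>n\<close> ones, so that the
    inner expectation is taken with the past \<open>i\<close> fixed.\<close>
  have Q_Suc: "Q (Suc n) = Q n \<bind> (\<lambda>i. map_pmf (\<lambda>x. i(n := x)) (pmf_of_set (S n)))"
    unfolding Q_def lessThan_Suc by (subst Pi_pmf_insert')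
       (auto simp: map_pmf_def intro: bind_commute_pmf)
  have inner: "measure_pmf.expectation (map_pmf (\<lambda>x. i(n := x)) (pmf_of_set (S n)))
        (\<lambda>i. urn_potential k (picks k i (v i) M (Suc n)))
      \<le> urn_potential k (picks k i (v i) M n) * (1 - 1 / (2 * (real k * real n + 1)))"
    if "i \<in> set_pmf (Q n)" for i
  proof -
    from that have iS: "i t \<in> S t" if "t < n" for t
      using that by (auto simp: setQ PiE_dflt_def)
    have ch: "i \<in> choices k" unfolding choices_def
    proof safe
      fix t show "i t \<le> k * t"
        using \<open>i \<in> set_pmf (Q n)\<close> S(1)[of t] iS[of t] unfolding setQ PiE_dflt_def
        by (cases "t < n") auto
    qed
    have "i \<in> all_steps M S" using iS step(1) by (auto simp: all_steps_def)
    from v[OF ch this] obtain q where q: "q \<le> k * M" "q \<notin> F" "v i \<in> set (ktree_clique k i q)" by auto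
    define p where "p = picks k i (v i) M n"
    define w where "w = 1 + (real k - 1) * real p"
    define W where "W = {x \<in> S n. v i \<in> set (ktree_clique k i x)}"
    have w: "w \<ge> 1" using k by (simp add: w_def)
    have Sn: "S n = {..k * n} - F" by (rule SF[OF step(1)])
    have "1 + (k - 1) * p \<le> card W"
      using card_cliques_containing[OF _ ch q(1,3) F q(2) step(1)] k by (simp add: p_def W_def Sn)
    hence "real (1 + (k - 1) * p) \<le> real (card W)" by (rule of_nat_mono)
    hence cW: "w \<le> real (card W)" using k by (simp add: w_def of_nat_diff)
    have "card (S n) \<le> card {..k * n}" using S(1) by (intro card_mono) auto
    hence cS: "real (card (S n)) \<le> real k * real n + 1" "card (S n) > 0"
      using finS S(2) by (auto simp: card_gt_0_iff simp flip: of_nat_mult)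
    have "measure_pmf.expectation (map_pmf (\<lambda>x. i(n := x)) (pmf_of_set (S n)))
        (\<lambda>i. urn_potential k (picks k i (v i) M (Suc n)))
      = measure_pmf.expectation (pmf_of_set (S n))
        (\<lambda>x. if v i \<in> set (ktree_clique k i x) then urn_potential k (Suc p) else urn_potential k p)"
    proof (subst integral_map_pmf, rule integral_cong_AE)
      have "urn_potential k (picks k (i(n := x)) (v (i(n := x))) M (Suc n)) =
          (if v i \<in> set (ktree_clique k i x) then urn_potential k (Suc p) else urn_potential k p)"
        if "x \<in> S n" for x
      proof -
        have x: "x \<le> k * n" using S(1) that by auto
        have "v (i(n := x)) = v i"
          by (rule v_cong) (use ch x step(1) in \<open>auto simp: choices_def\<close>)
        thus ?thesis using picks_upd[OF _ ch x step(1)] k by (simp add: p_def)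
      qed
      thus "AE x in measure_pmf (pmf_of_set (S n)).
         urn_potential k (picks k (i(n := x)) (v (i(n := x))) M (Suc n)) =
          (if v i \<in> set (ktree_clique k i x) then urn_potential k (Suc p) else urn_potential k p)"
        using finS S(2) by (simp add: AE_measure_pmf_iff)
    qed simp_all
    also have "\<dots> = urn_potential k p -
        (urn_potential k p - urn_potential k (Suc p)) * (real (card W) / real (card (S n)))"
      using finS S(2) by (simp add: pmf_of_set_expectation_two_valued W_def)
    also have "\<dots> = urn_potential k p * (1 - 1 / (2 * w) * (real (card W) / real (card (S n))))"
      by (simp add: urn_potential_Suc w_def algebra_simps)
    \<comment> \<open>At least \<open>w\<close> of at most \<open>k * n + 1\<close> admissible
      cliques contain the vertex, and this \<open>w\<close> cancels the one in the factor of the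
      potential.\<close>
    also have "\<dots> \<le> urn_potential k p * (1 - 1 / (2 * w) * (w / (real k * real n + 1)))"
      using cW cS w urn_potential_pos[of k p] k
      by (intro mult_left_mono diff_left_mono frac_le) auto
    also have "\<dots> = urn_potential k p * (1 - 1 / (2 * (real k * real n + 1)))"
      using w by simp
    finally show ?thesis by (simp add: p_def)
  qed
  have "measure_pmf.expectation (Q (Suc n)) (\<lambda>i. urn_potential k (picks k i (v i) M (Suc n)))
      = (\<Sum>i\<in>set_pmf (Q n). pmf (Q n) i *
          measure_pmf.expectation (map_pmf (\<lambda>x. i(n := x)) (pmf_of_set (S n)))
        (\<lambda>i. urn_potential k (picks k i (v i) M (Suc n))))"
    unfolding Q_Suc using finQ finS S(2)
    by (subst pmf_expectation_bind[where A = "set_pmf (Q n)"]) auto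
  also have "\<dots> \<le> (\<Sum>i\<in>set_pmf (Q n). pmf (Q n) i *
      (urn_potential k (picks k i (v i) M n) * (1 - 1 / (2 * (real k * real n + 1)))))"
    by (intro sum_mono mult_left_mono inner) auto
  also have "\<dots> = measure_pmf.expectation (Q n) (\<lambda>i. urn_potential k (picks k i (v i) M n)) *
      (1 - 1 / (2 * (real k * real n + 1)))"
    using finQ by (subst integral_measure_pmf[of "set_pmf (Q n)"]) (auto simp: sum_distrib_left mult_ac)
  also have "\<dots> \<le> (\<Prod>t\<in>{M..<n}. 1 - 1 / (2 * (real k * real t + 1))) *
      (1 - 1 / (2 * (real k * real n + 1)))"
    using step.IH bd by (rule mult_right_mono)
  also have "\<dots> = (\<Prod>t\<in>{M..<Suc n}. 1 - 1 / (2 * (real k * real t + 1)))"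
    using step(1) by (simp add: prod.atLeastLessThan_Suc)
  finally show ?case .
qed

subsection \<open>Quantitative bounds\<close>

text \<open>With \<gamma> = 1 / (2 k), each factor is at most exp (-\<gamma> / (n + 1)), hence at
  most the power \<gamma> of (n + 1) / (n + 2); these bounds telescope.\<close>

lemma urn_product_upper:
  assumes "k \<ge> 1" "M \<le> n"
  shows "(\<Prod>t\<in>{M..<n}. 1 - 1 / (2 * (real k * real t + 1)))
    \<le> ((real M + 1) / (real n + 1)) powr (1 / (2 * real k))"
  using assms(2)
proof (induction n rule: dec_induct)
  case (step n)
  define \<gamma> where "\<gamma> = 1 / (2 * real k)"
  have \<gamma>: "\<gamma> > 0" using assms(1) by (simp add: \<gamma>_def)
  have "1 - 1 / (2 * (real k * real n + 1)) \<le> 1 - \<gamma> / (real n + 1)"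
  proof -
    have "2 * (real k * real n + 1) \<le> 2 * (real k * (real n + 1))"
      using assms(1) by (simp add: algebra_simps)
    hence "1 / (2 * (real k * (real n + 1))) \<le> 1 / (2 * (real k * real n + 1))"
      using assms(1) by (intro divide_left_mono) (auto intro!: mult_pos_pos add_nonneg_pos)
    thus ?thesis by (simp add: \<gamma>_def)
  qed
  also have "\<dots> \<le> exp (- \<gamma> / (real n + 1))"
    using exp_ge_add_one_self[of "- \<gamma> / (real n + 1)"] by simp
  also have "\<dots> = exp (- 1 / (real n + 1)) powr \<gamma>" by (simp add: exp_powr_real)
  also have "\<dots> \<le> ((real n + 1) / (real n + 2)) powr \<gamma>"
  proof (rule powr_mono2)
    have "1 + 1 / (real n + 1) \<le> exp (1 / (real n + 1))" by (rule exp_ge_add_one_self)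
    moreover have "1 + 1 / (real n + 1) = (real n + 2) / (real n + 1)" by (simp add: field_simps)
    ultimately have "inverse (exp (1 / (real n + 1))) \<le> inverse ((real n + 2) / (real n + 1))"
      by (intro le_imp_inverse_le) auto
    thus "exp (- 1 / (real n + 1)) \<le> (real n + 1) / (real n + 2)" by (simp add: exp_minus)
  qed (use \<gamma> in auto)
  finally have fac: "1 - 1 / (2 * (real k * real n + 1)) \<le> ((real n + 1) / (real n + 2)) powr \<gamma>" .
  have nonneg: "1 - 1 / (2 * (real k * real t + 1)) \<ge> 0" for t
    by (auto simp: divide_simps add_nonneg_pos)
  have "(\<Prod>t\<in>{M..<Suc n}. 1 - 1 / (2 * (real k * real t + 1))) =
    (\<Prod>t\<in>{M..<n}. 1 - 1 / (2 * (real k * real t + 1))) * (1 - 1 / (2 * (real k * real n + 1)))"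
    using step(1) by (simp add: prod.atLeastLessThan_Suc)
  also have "\<dots> \<le> ((real M + 1) / (real n + 1)) powr \<gamma> * ((real n + 1) / (real n + 2)) powr \<gamma>"
    using step.IH fac nonneg unfolding \<gamma>_def by (intro mult_mono) auto
  also have "\<dots> = ((real M + 1) / (real (Suc n) + 1)) powr \<gamma>"
    by (simp add: powr_mult[symmetric] add_ac)
  finally show ?case by (simp add: \<gamma>_def)
qed simp

text \<open>The quotient in Markov's inequality for the urn potential: the first line bounds the
  reciprocal of the potential at \<open>D\<close> picks, the second one its expectation.\<close>

definition degree_tail :: "nat \<Rightarrow> nat \<Rightarrow> nat \<Rightarrow> real \<Rightarrow> real" where
  "degree_tail k M n D = 2 * (2 * real k * (D + 1)) powr (1 / (2 * (real k - 1))) *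
     ((real M + 1) / (real n + 1)) powr (1 / (2 * real k))"

lemma prob_few_picks:
  fixes S :: "nat \<Rightarrow> nat set" and v :: "(nat \<Rightarrow> nat) \<Rightarrow> nat"
  assumes k: "k \<ge> 2" and S: "\<And>t. S t \<subseteq> {..k * t}" "\<And>t. S t \<noteq> {}"
    and SF: "\<And>t. t \<ge> M \<Longrightarrow> S t = {..k * t} - F" and F: "F \<subseteq> {..k * M}"
    and v: "\<And>i. i \<in> choices k \<Longrightarrow> i \<in> all_steps M S \<Longrightarrow>
       \<exists>q \<le> k * M. q \<notin> F \<and> v i \<in> set (ktree_clique k i q)"
    and v_cong: "\<And>i i'. i \<in> choices k \<Longrightarrow> i' \<in> choices k \<Longrightarrow> (\<And>t. t < M \<Longrightarrow> i t = i' t) \<Longrightarrow> v i = v i'"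
    and Mn: "M \<le> n" and D: "D \<ge> 0"
  shows "measure_pmf.prob (Pi_pmf {..<n} 0 (\<lambda>t. pmf_of_set (S t)))
      {i. real (picks k i (v i) M n) < D} \<le> degree_tail k M n D"
proof -
  define Q where "Q = Pi_pmf {..<n} 0 (\<lambda>t. pmf_of_set (S t))"
  define \<theta> where "\<theta> = 1 / (2 * (real k - 1))"
  define c where "c = 1 / 2 * (\<theta> / (D + \<theta>)) powr \<theta>"
  have \<theta>: "\<theta> > 0" "\<theta> \<le> 1" using k by (simp_all add: \<theta>_def)
  have c: "c > 0" using \<theta> D by (simp add: c_def)
  have finS: "finite (S t)" for t using S(1) finite_subset by blast
  have finQ: "finite (set_pmf Q)"
    unfolding Q_def using finS S(2) by (subst set_Pi_pmf) (auto simp: o_def set_pmf_of_set)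
  \<comment> \<open>Few picks mean a large potential. The lower bound is available at
    \<open>Suc p\<close>, and passing to \<open>p\<close> only increases the potential.\<close>
  have "{i. real (picks k i (v i) M n) < D} \<subseteq> {i. urn_potential k (picks k i (v i) M n) \<ge> c}"
  proof safe
    fix i assume lt: "real (picks k i (v i) M n) < D"
    define p where "p = picks k i (v i) M n"
    have "c \<le> 1 / 2 * (\<theta> / (real p + \<theta>)) powr \<theta>"
      unfolding c_def using \<theta> lt D
      by (intro mult_left_mono powr_mono2 divide_left_mono) (auto simp: p_def intro: add_nonneg_pos)
    also have "\<dots> \<le> urn_potential k (Suc p)"
      using urn_potential_lower[OF k, of p] by (simp add: \<theta>_def)
    also have "\<dots> \<le> urn_potential k p" using k by (intro urn_potential_antimono) auto
    finally show "c \<le> urn_potential k (picks k i (v i) M n)" by (simp add: p_def)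
  qed
  hence "measure_pmf.prob Q {i. real (picks k i (v i) M n) < D}
      \<le> measure_pmf.prob Q {i. urn_potential k (picks k i (v i) M n) \<ge> c}"
    by (intro measure_pmf.finite_measure_mono) auto
  also have "\<dots> \<le> measure_pmf.expectation Q (\<lambda>i. urn_potential k (picks k i (v i) M n)) / c"
    using k finQ c by (intro pmf_markov) (auto intro!: less_imp_le[OF urn_potential_pos])
  also have "\<dots> \<le> ((real M + 1) / (real n + 1)) powr (1 / (2 * real k)) / c"
  proof (rule divide_right_mono)
    have "measure_pmf.expectation Q (\<lambda>i. urn_potential k (picks k i (v i) M n))
        \<le> (\<Prod>t\<in>{M..<n}. 1 - 1 / (2 * (real k * real t + 1)))"
      unfolding Q_def by (rule expected_potential) fact+
    also have "\<dots> \<le> ((real M + 1) / (real n + 1)) powr (1 / (2 * real k))"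
      using k Mn by (intro urn_product_upper) auto
    finally show "measure_pmf.expectation Q (\<lambda>i. urn_potential k (picks k i (v i) M n))
      \<le> ((real M + 1) / (real n + 1)) powr (1 / (2 * real k))" .
  qed (use c in simp)
  also have "1 / c = 2 * ((D + \<theta>) / \<theta>) powr \<theta>"
    using \<theta> D by (simp add: c_def powr_divide)
  hence "((real M + 1) / (real n + 1)) powr (1 / (2 * real k)) / c =
      2 * ((D + \<theta>) / \<theta>) powr \<theta> * ((real M + 1) / (real n + 1)) powr (1 / (2 * real k))"
    by (metis (no_types, lifting) divide_inverse inverse_eq_divide mult.commute)
  also have "\<dots> \<le> degree_tail k M n D"
    unfolding degree_tail_def \<theta>_def[symmetric]
  proof (intro mult_right_mono mult_left_mono powr_mono2)
    have "(D + \<theta>) / \<theta> = (2 * (real k - 1)) * (D + \<theta>)" using k by (simp add: \<theta>_def)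
    also have "\<dots> \<le> 2 * real k * (D + 1)" using k D \<theta> by (intro mult_mono) auto
    finally show "(D + \<theta>) / \<theta> \<le> 2 * real k * (D + 1)" .
  qed (use \<theta> D in auto)
  finally show ?thesis by (simp add: Q_def)
qed

text \<open>The defect of a barrier: some endpoint of the cut is picked too rarely. Counting starts
  at \<open>M\<close>, later chosen beyond all windows, so that the chain itself is already
  fixed.\<close>

definition low_degree :: "nat \<Rightarrow> (nat \<Rightarrow> nat) \<Rightarrow> nat \<Rightarrow> nat \<Rightarrow> real \<Rightarrow> (nat \<Rightarrow> nat) set" where
  "low_degree k \<tau> M n D = {i. \<exists>v \<in> set (ktree_clique k i (i (\<tau> 0))) \<union> (\<lambda>j. k + \<tau> j) ` {..<k}.
     real (picks k i v M n) < D}"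

text \<open>Given the chain event, the steps are independent and uniform on the admissible sets,
  which from \<open>M\<close> on exclude just the mixed cliques. So the urn estimate applies to each
  of the 2 k endpoints: a near vertex starts with the clique \<open>i (\<tau> 0)\<close>, a far one
  with the end clique.\<close>

lemma prob_low_degree:
  assumes k: "k \<ge> 2" and \<tau>: "\<tau> \<in> candidates k m" and m: "m \<ge> k"
    and M: "M = Suc k * m" "M \<le> n" and D: "D \<ge> 0"
  shows "measure_pmf.prob (choice_pmf k n) (all_steps n (chain_steps k \<tau>) \<inter> low_degree k \<tau> M n D)
    \<le> 2 * real k * degree_tail k M n D * chain_prob k n \<tau>"
proof -
  let ?Q = "Pi_pmf {..<n} 0 (\<lambda>t. pmf_of_set (chain_steps k \<tau> t))"
  define c where "c = k * \<tau> (k - 1) + 1"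
  have k0: "k > 0" using k by simp
  have ne: "chain_steps k \<tau> t \<noteq> {}" for t using chain_steps_nonempty[OF \<tau> k0 m] .
  note sub = chain_steps_subset[OF \<tau>]
  have finS: "finite (chain_steps k \<tau> t)" for t using sub finite_subset by blast
  have \<tau>M: "\<tau> j < M" if "j < k" for j using candidate_less[OF \<tau> that] M by simp
  have idx: "k * \<tau> j + 1 + r \<le> k * M" if "j < k" "r < k" for j r
  proof -
    have "k * Suc (\<tau> j) \<le> k * M" using \<tau>M[OF that(1)] by (intro mult_left_mono) auto
    thus ?thesis using that by simp
  qed
  have SF: "chain_steps k \<tau> t = {..k * t} - forbidden k \<tau>" if "t \<ge> M" for t
  proof -
    have "t \<notin> \<tau> ` {1..<k}" using \<tau>M that by fastforce
    thus ?thesis by (simp add: chain_steps_def)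
  qed
  have F: "forbidden k \<tau> \<subseteq> {..k * M}"
  proof
    fix x assume "x \<in> forbidden k \<tau>"
    then obtain j r where "j < k" "r < k" "x = k * \<tau> j + 1 + r" by (rule forbiddenE)
    with idx[of j r] show "x \<in> {..k * M}" by simp
  qed
  \<comment> \<open>The clique picked at \<open>\<tau> 0\<close> exists before that time, whereas
    every forbidden index is created at \<open>\<tau> 0\<close> or later.\<close>
  have q_near: "i (\<tau> 0) \<le> k * M \<and> i (\<tau> 0) \<notin> forbidden k \<tau>" if "i \<in> choices k" for i
  proof -
    have le: "i (\<tau> 0) \<le> k * \<tau> 0" using choicesD[OF that] .
    also have "\<dots> \<le> k * M" using \<tau>M[OF k0] by (intro mult_left_mono) auto
    finally have "i (\<tau> 0) \<le> k * M" .
    moreover have "i (\<tau> 0) \<notin> forbidden k \<tau>"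
    proof
      assume "i (\<tau> 0) \<in> forbidden k \<tau>"
      then obtain j r where j: "j < k" "i (\<tau> 0) = k * \<tau> j + 1 + r" by (rule forbiddenE)
      have "\<tau> 0 \<le> \<tau> j" using candidate_mono[OF \<tau>, of 0 j] j by (cases "j = 0") auto
      hence "k * \<tau> 0 \<le> k * \<tau> j" by (rule mult_left_mono) simp
      with j le show False by linarith
    qed
    ultimately show ?thesis ..
  qed
  have q_far: "c \<le> k * M \<and> c \<notin> forbidden k \<tau>"
    using idx[of "k - 1" 0] k0 by (simp add: c_def forbidden_def)
  have near: "measure_pmf.prob ?Q {i. real (picks k i (ktree_clique k i (i (\<tau> 0)) ! l) M n) < D}
      \<le> degree_tail k M n D" if l: "l < k" for l
  proof (rule prob_few_picks[OF k sub ne SF F _ _ M(2) D])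
    fix i assume "i \<in> choices k"
    with q_near[OF this] l ktree_clique_length[OF this k0]
    show "\<exists>q\<le>k * M. q \<notin> forbidden k \<tau> \<and> ktree_clique k i (i (\<tau> 0)) ! l \<in> set (ktree_clique k i q)"
      by (auto intro!: exI[of _ "i (\<tau> 0)"])
  next
    fix i i' :: "nat \<Rightarrow> nat"
    assume i: "i \<in> choices k" "i' \<in> choices k" "\<And>t. t < M \<Longrightarrow> i t = i' t"
    hence "i (\<tau> 0) = i' (\<tau> 0)" using \<tau>M[OF k0] by simp
    with ktree_clique_cong[OF i(1,2) k0 i(3)] q_near[OF i(2)]
    show "ktree_clique k i (i (\<tau> 0)) ! l = ktree_clique k i' (i' (\<tau> 0)) ! l" by simp
  qed
  have far: "measure_pmf.prob ?Q {i. real (picks k i (k + \<tau> l) M n) < D}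
      \<le> degree_tail k M n D" if l: "l < k" for l
  proof (rule prob_few_picks[OF k sub ne SF F _ _ M(2) D, where v = "\<lambda>_. k + \<tau> l"])
    fix i assume i: "i \<in> choices k" "i \<in> all_steps M (chain_steps k \<tau>)"
    \<comment> \<open>The horizon is \<open>M\<close> here: the chain is complete by then, and only
      the steps before \<open>M\<close> are known to be admissible.\<close>
    interpret barrier_chain k M \<tau> i
      using i k \<tau> M by (intro barrier_chain_candidate) auto
    show "\<exists>q\<le>k * M. q \<notin> forbidden k \<tau> \<and> k + \<tau> l \<in> set (ktree_clique k i q)"
      using q_far last_clique l by (auto simp: c_def far_clique_def intro!: exI[of _ c])
  qed auto
  define NN where "NN l = {i. real (picks k i (ktree_clique k i (i (\<tau> 0)) ! l) M n) < D}" for l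
  define FF where "FF l = {i. real (picks k i (k + \<tau> l) M n) < D}" for l
  have supp: "set_pmf ?Q \<subseteq> choices k"
  proof
    fix i assume "i \<in> set_pmf ?Q"
    hence "i \<in> PiE_dflt {..<n} 0 (chain_steps k \<tau>)"
      using ne finS by (subst (asm) set_Pi_pmf) (auto simp: o_def set_pmf_of_set)
    hence *: "i t \<in> chain_steps k \<tau> t \<or> i t = 0" for t
      by (cases "t < n") (auto simp: PiE_dflt_def)
    show "i \<in> choices k" unfolding choices_def
    proof safe
      fix t show "i t \<le> k * t" using *[of t] sub[of t] by auto
    qed
  qed
  have "measure_pmf.prob ?Q (low_degree k \<tau> M n D) = measure_pmf.prob ?Q (low_degree k \<tau> M n D \<inter> set_pmf ?Q)"
    by (rule measure_Int_set_pmf[symmetric])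
  also have "\<dots> \<le> measure_pmf.prob ?Q ((\<Union>l<k. NN l) \<union> (\<Union>l<k. FF l))"
  proof (rule measure_pmf.finite_measure_mono)
    show "low_degree k \<tau> M n D \<inter> set_pmf ?Q \<subseteq> (\<Union>l<k. NN l) \<union> (\<Union>l<k. FF l)"
    proof
      fix i assume i: "i \<in> low_degree k \<tau> M n D \<inter> set_pmf ?Q"
      hence "length (ktree_clique k i (i (\<tau> 0))) = k" using supp k0 by auto
      with i show "i \<in> (\<Union>l<k. NN l) \<union> (\<Union>l<k. FF l)"
        by (fastforce simp: low_degree_def NN_def FF_def in_set_conv_nth)
    qed
  qed simp
  also have "\<dots> \<le> measure_pmf.prob ?Q (\<Union>l<k. NN l) + measure_pmf.prob ?Q (\<Union>l<k. FF l)"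
    by (intro measure_Un_le) auto
  also have "\<dots> \<le> (\<Sum>l<k. measure_pmf.prob ?Q (NN l)) + (\<Sum>l<k. measure_pmf.prob ?Q (FF l))"
    by (intro add_mono measure_pmf.finite_measure_subadditive_finite) auto
  also have "\<dots> \<le> (\<Sum>l<k. degree_tail k M n D) + (\<Sum>l<k. degree_tail k M n D)"
    using near far by (intro add_mono sum_mono) (auto simp: NN_def FF_def)
  finally have le: "measure_pmf.prob ?Q (low_degree k \<tau> M n D) \<le> 2 * real k * degree_tail k M n D" by simp
  have "measure_pmf.prob (choice_pmf k n) (all_steps n (chain_steps k \<tau>) \<inter> low_degree k \<tau> M n D) =
      chain_prob k n \<tau> * measure_pmf.prob ?Q (low_degree k \<tau> M n D)"
    unfolding chain_prob_def by (rule prob_all_steps_conditional[OF sub ne])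
  also have "\<dots> \<le> chain_prob k n \<tau> * (2 * real k * degree_tail k M n D)"
    by (rule mult_left_mono[OF le]) (simp add: chain_prob_def prod_nonneg)
  finally show ?thesis by (simp add: mult_ac)
qed

text \<open>Puts the probability of avoiding k^2 - 1 cliques into telescoping form. With N = k t +
  1, a = k^2 - 1 and y = t - k one has N - a \<ge> k y, and 1 - a / N = 1 / (1 + a / (N - a)) is at
  least exp (-a / (k y)), hence at least the power a / k of (y - 1) / y.\<close>

lemma avoid_factor_lower:
  assumes "k \<ge> 1" "t > k + 1"
  shows "((real t - real k - 1) / (real t - real k)) powr ((real k ^ 2 - 1) / real k)
     \<le> 1 - (real k ^ 2 - 1) / (real k * real t + 1)"
proof -
  define y where "y = real t - real k"
  define a where "a = real k ^ 2 - 1"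
  define N where "N = real k * real t + 1"
  have y: "y > 1" using assms by (simp add: y_def)
  have a: "a \<ge> 0" using assms by (simp add: a_def)
  have Na: "N - a \<ge> real k * y" using assms by (simp add: N_def a_def y_def algebra_simps power2_eq_square)
  have ky: "real k * y > 0" using y assms by simp
  have "((y - 1) / y) powr (a / real k) \<le> exp (- 1 / y) powr (a / real k)"
  proof (rule powr_mono2)
    have "1 + - 1 / y \<le> exp (- 1 / y)" by (rule exp_ge_add_one_self)
    thus "(y - 1) / y \<le> exp (- 1 / y)" using y by (simp add: diff_divide_distrib)
  qed (use a y in auto)
  also have "\<dots> = exp (- (a / (real k * y)))" by (simp add: exp_powr_real mult_ac)
  also have "\<dots> \<le> exp (- (a / (N - a)))"
    using a Na ky by (auto intro!: divide_left_mono)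
  also have "\<dots> = 1 / exp (a / (N - a))" by (simp add: exp_minus inverse_eq_divide)
  also have "\<dots> \<le> 1 / (1 + a / (N - a))"
    using a Na ky by (intro divide_left_mono exp_ge_add_one_self) (auto intro!: mult_pos_pos add_pos_nonneg)
  also have "\<dots> = 1 - a / N"
  proof -
    have "N - a > 0" using Na ky by linarith
    moreover from this have "N > 0" using a by linarith
    ultimately show ?thesis by (simp add: field_simps)
  qed
  finally show ?thesis by (simp add: y_def a_def N_def algebra_simps)
qed

text \<open>Steps before \<open>m\<close> cost nothing, each of the \<open>k - 1\<close> prescribed
  picks has probability at least 1 / (k M), and the avoidance factors from \<open>m\<close> to
  \<open>n\<close> telescope to a power of about m / n.\<close>

lemma chain_prob_lower:
  assumes k: "k \<ge> 2" and \<tau>: "\<tau> \<in> candidates k m" and m: "m \<ge> 2 * k + 2" and M: "M = Suc k * m" "M \<le> n"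
  shows "chain_prob k n \<tau> \<ge> (1 / (real k * real M)) ^ (k - 1) *
     (real m / (2 * real n)) powr ((real k ^ 2 - 1) / real k)"
proof -
  define b where "b = (real k ^ 2 - 1) / real k"
  define u where "u t = ((real t - real k - 1) / (real t - real k)) powr b" for t
  define Z where "Z = \<tau> ` {1..<k}"
  have b: "b \<ge> 0" using k by (simp add: b_def)
  have mM: "m \<le> M" using M by simp
  have kM: "real k * real M \<ge> 1" using k m mM
    by (metis One_nat_def mult_eq_0_iff of_nat_1 of_nat_le_iff of_nat_mult le_zero_eq not_less_eq_eq add_2_eq_Suc' not_less_eq_eq zero_le numeral_2_eq_2)
  have "(\<Prod>t\<in>{m..<n}. u t) = ((real m - real k - 1) / (real n - real k - 1)) powr b"
    if "m \<le> n" using that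
  proof (induction n rule: dec_induct)
    case base
    show ?case using m by simp
  next
    case (step n)
    have "(\<Prod>t\<in>{m..<Suc n}. u t) = ((real m - real k - 1) / (real n - real k - 1)) powr b * u n"
      using step by (simp add: prod.atLeastLessThan_Suc)
    also have "\<dots> = ((real m - real k - 1) / (real n - real k - 1) *
        ((real n - real k - 1) / (real n - real k))) powr b"
      unfolding u_def using step(1) m by (subst powr_mult) auto
    also have "(real m - real k - 1) / (real n - real k - 1) * ((real n - real k - 1) / (real n - real k))
        = (real m - real k - 1) / (real (Suc n) - real k - 1)"
      using step(1) m by simp
    finally show ?case .
  qed
  hence tele: "(\<Prod>t\<in>{m..<n}. u t) = ((real m - real k - 1) / (real n - real k - 1)) powr b"
    using mM M by simp
  have u01: "0 \<le> u t" "t \<ge> m \<Longrightarrow> u t \<le> 1" for t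
    using b m by (auto simp: u_def intro!: powr_le1)
  \<comment> \<open>The factor \<open>u t \<le> 1\<close> is kept at the prescribed picks as well,
    so that the product over all times from \<open>m\<close> on telescopes.\<close>
  have step: "(if t < m then 1 else u t) * (if t \<in> Z then 1 / (real k * real M) else 1)
      \<le> real (card (chain_steps k \<tau> t)) / real (k * t + 1)" for t
  proof -
    consider "t < m" | j where "t = \<tau> (Suc j)" "Suc j < k" | "t \<ge> m" "t \<notin> Z"
    proof (cases "t \<in> Z")
      case True
      then obtain l where "l \<ge> 1" "l < k" "t = \<tau> l" by (auto simp: Z_def)
      with that(2)[of "l - 1"] show ?thesis by auto
    qed (use that(1,3) not_less in blast)
    thus ?thesis
    proof cases
      case 1
      have "t \<notin> Z" using 1 candidate_less[OF \<tau>] by (fastforce simp: Z_def)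
      have one: "real (card (chain_steps k \<tau> t)) / real (k * t + 1) = 1"
        unfolding chain_steps_full[OF \<tau> 1] card_atMost Suc_eq_plus1
        by (rule divide_self, unfold of_nat_eq_0_iff) simp
      show ?thesis unfolding one using 1 \<open>t \<notin> Z\<close> by simp
    next
      case 2
      have tm: "m \<le> t" "t < M" using candidate_less[OF \<tau> 2(2)] 2 M by auto
      have "k * Suc t \<le> k * M" using tm by (intro mult_left_mono) auto
      hence "k * t + 1 \<le> k * M" using k by simp
      hence "real (k * t + 1) \<le> real (k * M)" by (simp only: of_nat_le_iff)
      hence "1 / real (k * M) \<le> 1 / real (k * t + 1)"
        by (rule frac_le[OF _ order_refl, rotated 2]) (simp_all add: add_pos_nonneg)
      moreover have "u t * (1 / real (k * M)) \<le> 1 * (1 / real (k * M))"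
        using u01(2)[OF tm(1)] by (intro mult_right_mono) auto
      moreover have "t \<in> Z" using 2 by (auto simp: Z_def)
      moreover have "card (chain_steps k \<tau> t) = 1" using chain_steps_pick[OF \<tau> 2(2)] 2(1) by simp
      ultimately show ?thesis using tm by simp
    next
      case 3
      have "card (chain_steps k \<tau> t) \<ge> k * t + 1 - (k\<^sup>2 - 1)"
        using card_chain_steps_other[of k t \<tau>] 3 k by (simp add: Z_def)
      moreover have "real (k\<^sup>2 - 1) = real k ^ 2 - 1" using k by (simp add: of_nat_diff)
      ultimately have "real (card (chain_steps k \<tau> t)) \<ge> real (k * t + 1) - (real k ^ 2 - 1)" by linarith
      hence "(real (k * t + 1) - (real k ^ 2 - 1)) / real (k * t + 1)
          \<le> real (card (chain_steps k \<tau> t)) / real (k * t + 1)"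
        by (rule divide_right_mono) simp
      moreover have "u t \<le> (real (k * t + 1) - (real k ^ 2 - 1)) / real (k * t + 1)"
      proof -
        have N: "real (k * t + 1) \<noteq> 0" unfolding of_nat_eq_0_iff by simp
        have "u t \<le> 1 - (real k ^ 2 - 1) / (real k * real t + 1)"
          unfolding u_def b_def using k m 3 by (intro avoid_factor_lower) auto
        also have "real k * real t + 1 = real (k * t + 1)" by simp
        also have "1 - (real k ^ 2 - 1) / real (k * t + 1)
            = (real (k * t + 1) - (real k ^ 2 - 1)) / real (k * t + 1)"
          by (simp only: diff_divide_distrib divide_self[OF N])
        finally show ?thesis .
      qed
      ultimately have "u t \<le> real (card (chain_steps k \<tau> t)) / real (k * t + 1)" by (rule order_trans[rotated])
      thus ?thesis using 3 by simp
    qed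
  qed
  have "(1 / (real k * real M)) ^ (k - 1) * (real m / (2 * real n)) powr b
      \<le> (1 / (real k * real M)) ^ card ({..<n} \<inter> Z) * ((real m - real k - 1) / (real n - real k - 1)) powr b"
  proof (intro mult_mono powr_mono2 power_decreasing)
    have "card ({..<n} \<inter> Z) \<le> card Z" by (intro card_mono) (auto simp: Z_def)
    also have "\<dots> \<le> card {1..<k}" unfolding Z_def by (rule card_image_le) simp
    finally show "card ({..<n} \<inter> Z) \<le> k - 1" by simp
    \<comment> \<open>The assumption \<open>m \<ge> 2 * k + 2\<close> gives m - k - 1 \<ge> m /
      2.\<close>
    have "real m / (2 * real n) = (real m / 2) / real n" by simp
    also have "\<dots> \<le> (real m - real k - 1) / (real n - real k - 1)"
      using m mM M by (intro frac_le) auto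
    finally show "real m / (2 * real n) \<le> (real m - real k - 1) / (real n - real k - 1)" .
  qed (use b kM in auto)
  also have "\<dots> = (\<Prod>t<n. (if t < m then 1 else u t) * (if t \<in> Z then 1 / (real k * real M) else 1))"
  proof -
    have "(\<Prod>t<n. if t < m then 1 else u t) = (\<Prod>t\<in>{m..<n}. u t)"
      by (rule prod.mono_neutral_cong_right) auto
    moreover have "(\<Prod>t<n. if t \<in> Z then 1 / (real k * real M) else 1)
        = (1 / (real k * real M)) ^ card ({..<n} \<inter> Z)"
      by (simp add: prod.If_cases)
    ultimately show ?thesis by (simp only: prod.distrib tele mult.commute)
  qed
  also have "\<dots> \<le> chain_prob k n \<tau>"
    unfolding chain_prob_def using u01 step by (intro prod_mono) (auto simp: not_less)
  finally show ?thesis by (simp add: b_def)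
qed

text \<open>The second moment bound with barriers as events and low degrees as defects. There are
  \<open>m ^ k\<close> candidates, and the \<open>k - 1\<close> prescribed picks cost order m^(k-1),
  so the expected number of chains is at least of order m (m / n)^b.\<close>

lemma prob_no_barrier:
  assumes k: "k \<ge> 2" and m: "m \<ge> 2 * k + 2" and M: "M = Suc k * m" "M \<le> n" and D: "D \<ge> 0"
  shows "measure_pmf.prob (choice_pmf k n)
      {i. \<not> (\<exists>\<tau>\<in>candidates k m. i \<in> all_steps n (chain_steps k \<tau>) - low_degree k \<tau> M n D)}
    \<le> 4 * ((real k * (real k + 1)) ^ (k - 1) /
           (real m * (real m / (2 * real n)) powr ((real k ^ 2 - 1) / real k))
         + ((real m / real (m - k)) ^ (2 * k) - 1)) + 4 * real k * degree_tail k M n D"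
proof -
  define \<mu> where "\<mu> = (\<Sum>\<tau>\<in>candidates k m. chain_prob k n \<tau>)"
  define b where "b = (real k ^ 2 - 1) / real k"
  define c where "c = (real m / real (m - k)) ^ (2 * k)"
  define l where "l = (1 / (real k * real M)) ^ (k - 1) * (real m / (2 * real n)) powr b"
  define C where "C = (real k * (real k + 1)) ^ (k - 1)"
  have m0: "m > 0" and n0: "n > 0" using m M by auto
  have "real (card (candidates k m)) * l \<le> \<mu>"
    unfolding \<mu>_def l_def b_def by (intro sum_bounded_below chain_prob_lower[OF k _ m M])
  also have "real (card (candidates k m)) * l = real m * (real m / (2 * real n)) powr b / C"
  proof -
    have "real m ^ k = real m * real m ^ (k - 1)" using k by (cases k) auto
    moreover have "(real k * real M) ^ (k - 1) = C * real m ^ (k - 1)"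
      unfolding C_def power_mult_distrib[symmetric] M by (simp add: algebra_simps)
    ultimately show ?thesis using m0
      by (simp add: card_candidates l_def power_one_over divide_simps)
  qed
  finally have \<mu>: "real m * (real m / (2 * real n)) powr b / C \<le> \<mu>" .
  have C: "C > 0" using k by (simp add: C_def)
  have pos: "real m * (real m / (2 * real n)) powr b / C > 0" using m0 n0 C by simp
  hence \<mu>0: "\<mu> > 0" using \<mu> by linarith
  have pair: "measure_pmf.prob (choice_pmf k n)
      (all_steps n (chain_steps k \<tau>) \<inter> all_steps n (chain_steps k \<tau>')) \<le> c * (chain_prob k n \<tau> * chain_prob k n \<tau>')"
    if \<tau>: "\<tau> \<in> candidates k m" "\<tau>' \<in> candidates k m" "\<tau> \<noteq> \<tau>'" for \<tau> \<tau>'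
  \<comment> \<open>Distinct candidates with a common time never occur together; without a common
    time they are almost uncorrelated.\<close>
  proof (cases "\<exists>j l. j < k \<and> l < k \<and> \<tau> j = \<tau>' l")
    case True
    then obtain j where j: "j < k" "\<tau> j = \<tau>' j" using candidate_same_index[OF \<tau>(1,2)] by metis
    have "set_pmf (choice_pmf k n) \<inter> (all_steps n (chain_steps k \<tau>) \<inter> all_steps n (chain_steps k \<tau>')) = {}"
      using chains_overlap[OF k M(2)[unfolded M(1)] _ \<tau>(1) _ \<tau>(2) _ j] set_choice_pmf \<tau>(3) by blast
    hence "measure_pmf.prob (choice_pmf k n)
      (all_steps n (chain_steps k \<tau>) \<inter> all_steps n (chain_steps k \<tau>')) = 0"
      by (simp add: measure_pmf_zero_iff)
    thus ?thesis by (simp add: c_def chain_prob_def prod_nonneg)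
  next
    case False
    thus ?thesis unfolding c_def using k m \<tau> by (intro prob_chain_pair) auto
  qed
  have "measure_pmf.prob (choice_pmf k n)
      {i. \<not> (\<exists>\<tau>\<in>candidates k m. i \<in> all_steps n (chain_steps k \<tau>) - low_degree k \<tau> M n D)}
    \<le> 4 * (1 / \<mu> + (c - 1)) + 2 * (2 * real k * degree_tail k M n D)"
  proof (rule second_moment_good_event[OF finite_candidates])
    have "finite (PiE_dflt {..<n} 0 (\<lambda>t. {..k * t}))" by auto
    thus "finite (set_pmf (choice_pmf k n))"
      unfolding choice_pmf_def by (subst set_Pi_pmf) (auto simp: o_def)
    show "measure_pmf.prob (choice_pmf k n) (all_steps n (chain_steps k \<tau>) \<inter> low_degree k \<tau> M n D)
         \<le> 2 * real k * degree_tail k M n D * chain_prob k n \<tau>" if "\<tau> \<in> candidates k m" for \<tau>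
      using prob_low_degree[OF k that _ M D] m by simp
  qed (use pair prob_chain \<mu>0 in \<open>auto simp: \<mu>_def c_def\<close>)
  moreover have "1 / \<mu> \<le> 1 / (real m * (real m / (2 * real n)) powr b / C)"
    by (rule frac_le[OF zero_le_one order_refl pos \<mu>])
  hence "1 / \<mu> \<le> C / (real m * (real m / (2 * real n)) powr b)" by simp
  ultimately show ?thesis unfolding b_def c_def C_def by simp
qed

text \<open>\<open>S\<close> is the side of the source. Only the 2 k vertices of the two end cliques
  have edges across, each at most \<open>k\<close> of them among at least \<open>D\<close>
  neighbors, so one round crosses the cut with probability at most 2 k^2 / D.\<close>

lemma rumor_confined:
  assumes k: "k \<ge> 2" and i: "i \<in> choices k" and \<tau>: "\<tau> \<in> candidates k m"
    and M: "Suc k * m \<le> n" and D: "D > 0"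
    and good: "i \<in> all_steps n (chain_steps k \<tau>)" "i \<notin> low_degree k \<tau> M' n D"
    and s: "s < n + k"
  shows "measure_pmf.prob (pp_trace {..<n + k} (ktree_edges k i n) s T) {tr. \<exists>I\<in>set tr. I = {..<n + k}}
    \<le> real T * (2 * (real k)\<^sup>2 / D)"
proof -
  interpret barrier_chain k n \<tau> i using k \<tau> M i good(1) by (rule barrier_chain_candidate)
  define V where "V = {..<n + k}"
  define E where "E = ktree_edges k i n"
  define S where "S = (if s \<in> far_side then V \<inter> far_side else V - far_side)"
  have nb: "nbrs E v \<noteq> {} \<and> nbrs E v \<subseteq> V" if "v \<in> V" for v
    using nbrs_ktree_nonempty[OF i k, of v n] nbrs_ktree_subset[OF i k0, of n v] that
    by (auto simp: V_def E_def add.commute)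
  have S: "S \<subseteq> V" "s \<in> S" "S \<noteq> V"
  proof -
    have "0 \<in> V - far_side" "k + \<tau> 0 \<in> V \<inter> far_side" "s \<in> V"
      using s far_side_nontrivial k0 by (simp_all add: V_def)
    thus "S \<subseteq> V" "s \<in> S" "S \<noteq> V" unfolding S_def by (cases "s \<in> far_side"; force)+
  qed
  have S_iff: "v \<in> S \<longleftrightarrow> ((v \<in> far_side) = (s \<in> far_side))" if "v \<in> V" for v
    using that by (auto simp: S_def)
  have deg: "real (card (nbrs E v)) \<ge> D" if "v \<in> near_clique \<union> far_clique" for v
  proof -
    have "D \<le> real (picks k i v M' n)"
      using good(2) that by (auto simp: low_degree_def near_clique_def far_clique_def not_less)
    also have "\<dots> \<le> real (card (nbrs E v))" unfolding E_def using picks_le_degree[OF i k0] by simp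
    finally show ?thesis .
  qed
  have summand: "real (card {u \<in> nbrs E v. (u \<in> S) \<noteq> (v \<in> S)}) / real (card (nbrs E v))
      \<le> (if v \<in> near_clique \<union> far_clique then real k / D else 0)" if v: "v \<in> V" for v
  proof -
    define X where "X = {u \<in> nbrs E v. (u \<in> S) \<noteq> (v \<in> S)}"
    have cross: "if v \<in> far_side then v \<in> far_clique \<and> u \<in> near_clique else v \<in> near_clique \<and> u \<in> far_clique"
      if u: "u \<in> X" for u
    proof -
      have "u \<in> V" using u nb[OF v] by (auto simp: X_def)
      hence ne: "(u \<in> far_side) \<noteq> (v \<in> far_side)" using u S_iff v by (auto simp: X_def)
      have e: "{u, v} \<in> ktree_edges k i n" "{v, u} \<in> ktree_edges k i n"
        using u by (auto simp: X_def nbrs_def E_def insert_commute)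
      show ?thesis using crossing_edge[OF e(1)] crossing_edge[OF e(2)] ne by auto
    qed
    show ?thesis
    proof (cases "v \<in> near_clique \<union> far_clique")
      case True
      have "X \<subseteq> near_clique \<or> X \<subseteq> far_clique" using cross by (cases "v \<in> far_side") auto
      hence "card X \<le> k" using card_barrier card_mono by metis
      hence "real (card X) / real (card (nbrs E v)) \<le> real k / D"
        using deg[OF True] D by (intro frac_le) auto
      with True show ?thesis by (simp add: X_def)
    next
      case False
      hence "X = {}" using cross by (metis UnI1 UnI2 equals0I)
      thus ?thesis unfolding X_def[symmetric] using False by simp
    qed
  qed
  have step: "measure_pmf.prob (pp_round V E I) {J. \<not> J \<subseteq> S} \<le> 2 * (real k)\<^sup>2 / D" if "I \<subseteq> S" for I
  proof -
    have "measure_pmf.prob (pp_round V E I) {J. \<not> J \<subseteq> S}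
       \<le> (\<Sum>v\<in>V. card {u \<in> nbrs E v. (u \<in> S) \<noteq> (v \<in> S)} / card (nbrs E v))"
      using nb S(1) that by (intro pp_round_escape) (auto simp: V_def)
    also have "\<dots> \<le> (\<Sum>v\<in>V. if v \<in> near_clique \<union> far_clique then real k / D else 0)"
      by (intro sum_mono summand)
    also have "\<dots> = real (card (V \<inter> (near_clique \<union> far_clique))) * (real k / D)"
      by (simp add: sum.If_cases V_def Int_def)
    also have "\<dots> \<le> real (2 * k) * (real k / D)"
    proof (intro mult_right_mono of_nat_mono)
      have "card (V \<inter> (near_clique \<union> far_clique)) \<le> card (near_clique \<union> far_clique)"
        using card_barrier by (intro card_mono) auto
      also have "\<dots> \<le> card near_clique + card far_clique" by (rule card_Un_le)
      finally show "card (V \<inter> (near_clique \<union> far_clique)) \<le> 2 * k" using card_barrier by simp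
    qed (use D in simp)
    finally show ?thesis by (simp add: power2_eq_square)
  qed
  have "measure_pmf.prob (pp_trace V E s T) {tr. \<exists>I\<in>set tr. I = V} \<le>
      measure_pmf.prob (pp_trace V E s T) {tr. \<exists>I\<in>set tr. \<not> I \<subseteq> S}"
    using S by (intro measure_pmf.finite_measure_mono) auto
  also have "\<dots> \<le> real T * (2 * (real k)\<^sup>2 / D)"
    using step D S(2) by (intro pp_trace_escape) auto
  finally show ?thesis by (simp add: V_def E_def)
qed

text \<open>Adds the probability of a graph without a good barrier to that of crossing one. The
  source may depend on the graph because the crossing bound holds for every source.\<close>

lemma prob_slow:
  assumes k: "k \<ge> 2" and m: "m \<ge> 2 * k + 2" and M: "M = Suc k * m" "M \<le> n" and D: "D > 0"
    and s: "\<And>E. s E < n + k"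
  shows "measure_pmf.prob (pp_experiment k n s T) {(E, tr). needs_at_least {..<n + k} R tr}
    \<ge> 1 - (4 * ((real k * (real k + 1)) ^ (k - 1) /
           (real m * (real m / (2 * real n)) powr ((real k ^ 2 - 1) / real k))
         + ((real m / real (m - k)) ^ (2 * k) - 1)) + 4 * real k * degree_tail k M n D
         + real T * (2 * (real k)\<^sup>2 / D))"
proof -
  let ?E = "\<lambda>i. ktree_edges k i n"
  let ?bad = "{i. \<not> (\<exists>\<tau>\<in>candidates k m. i \<in> all_steps n (chain_steps k \<tau>) - low_degree k \<tau> M n D)}"
  let ?slow = "{(E, tr). needs_at_least {..<n + k} R tr} :: (nat set set \<times> nat set list) set"
  have "measure_pmf.prob (pp_experiment k n s T) (- ?slow)
      = measure_pmf.prob (choice_pmf k n \<bind> (\<lambda>i. map_pmf (Pair (?E i)) (pp_trace {..<n + k} (?E i) (s (?E i)) T)))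
         (- ?slow)"
    using k by (simp add: pp_experiment_def random_ktree_eq bind_map_pmf)
  also have "\<dots> \<le> measure_pmf.prob (choice_pmf k n) ?bad + real T * (2 * (real k)\<^sup>2 / D)"
  proof (rule measure_bind_pmf_le_add)
    fix i assume i: "i \<in> set_pmf (choice_pmf k n)" "i \<notin> ?bad"
    then obtain \<tau> where \<tau>: "\<tau> \<in> candidates k m" "i \<in> all_steps n (chain_steps k \<tau>)" "i \<notin> low_degree k \<tau> M n D"
      by blast
    have "measure_pmf.prob (map_pmf (Pair (?E i)) (pp_trace {..<n + k} (?E i) (s (?E i)) T)) (- ?slow)
       \<le> measure_pmf.prob (pp_trace {..<n + k} (?E i) (s (?E i)) T) {tr. \<exists>I\<in>set tr. I = {..<n + k}}"
      unfolding measure_map_pmf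
      by (intro measure_pmf.finite_measure_mono) (force simp: needs_at_least_def in_set_conv_nth, simp)
    also have "\<dots> \<le> real T * (2 * (real k)\<^sup>2 / D)"
      using rumor_confined[OF k _ \<tau>(1) _ D \<tau>(2,3) s] i set_choice_pmf M by blast
    finally show "measure_pmf.prob (map_pmf (Pair (?E i)) (pp_trace {..<n + k} (?E i) (s (?E i)) T)) (- ?slow)
       \<le> real T * (2 * (real k)\<^sup>2 / D)" .
  qed (use D in simp)
  finally have "measure_pmf.prob (pp_experiment k n s T) (- ?slow) \<le>
    measure_pmf.prob (choice_pmf k n) ?bad + real T * (2 * (real k)\<^sup>2 / D)" .
  moreover have "measure_pmf.prob (pp_experiment k n s T) (- ?slow) =
      1 - measure_pmf.prob (pp_experiment k n s T) ?slow"
    using measure_pmf.prob_compl[of ?slow "pp_experiment k n s T"] by (simp add: Compl_eq_Diff_UNIV)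
  ultimately show ?thesis
    using prob_no_barrier[OF k m M less_imp_le[OF D]] by linarith
qed

subsection \<open>Asymptotics\<close>

text \<open>The first identity says that m (m / n)^b is of constant order at m = n^\<beta>, the
  threshold for a barrier. The second says that the degree tail is of constant order there for
  degree n^\<alpha>.\<close>

lemma powr_exponent_identities:
  fixes k :: nat
  assumes "k \<ge> 2"
  defines "\<alpha> \<equiv> (real k - 1) / (real k ^ 2 + real k - 1)"
    and "\<beta> \<equiv> (real k ^ 2 - 1) / (real k ^ 2 + real k - 1)"
  shows "\<alpha> > 0" "\<beta> > 0" "\<beta> < 1"
    "\<beta> + (\<beta> - 1) * ((real k ^ 2 - 1) / real k) = 0"
    "\<alpha> * (1 / (2 * (real k - 1))) + (\<beta> - 1) * (1 / (2 * real k)) = 0"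
proof -
  define d where "d = real k ^ 2 + real k - 1"
  have k: "real k \<ge> 2" using assms by simp
  have sq: "real k ^ 2 \<ge> 4" using power_mono[OF k, of 2] by simp
  hence d: "d > 0" using k unfolding d_def by linarith
  have \<alpha>: "\<alpha> = (real k - 1) / d" and \<beta>: "\<beta> = (real k ^ 2 - 1) / d" by (simp_all add: \<alpha>_def \<beta>_def d_def)
  show "\<alpha> > 0" "\<beta> > 0" using d k sq by (simp_all add: \<alpha> \<beta>)
  have \<beta>1: "\<beta> - 1 = - real k / d" using d by (simp add: \<beta> d_def field_simps)
  have "real k / d > 0" using d k by simp
  thus "\<beta> < 1" using \<beta>1 by simp
  show "\<beta> + (\<beta> - 1) * ((real k ^ 2 - 1) / real k) = 0"
    unfolding \<beta>1 using k d by (simp add: \<beta> field_simps)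
  show "\<alpha> * (1 / (2 * (real k - 1))) + (\<beta> - 1) * (1 / (2 * real k)) = 0"
    unfolding \<beta>1 using k d by (simp add: \<alpha> field_simps)
qed

text \<open>Read \<open>x\<close> as n and \<open>y\<close> as m: at the threshold the powers of
  \<open>x\<close> cancel by the first exponent identity, and the surplus \<open>sqrt g\<close>
  remains. Its further power \<open>sqrt g powr b \<ge> 1\<close> is dropped.\<close>

lemma barrier_count_bound:
  fixes x y g b \<beta> :: real
  assumes g: "g \<ge> 1" and x: "x \<ge> 1" and b: "b \<ge> 0" and id: "\<beta> + (\<beta> - 1) * b = 0"
    and y: "y \<ge> x powr \<beta> * sqrt g"
  shows "y * (y / (2 * x)) powr b \<ge> sqrt g / 2 powr b"
proof -
  have "sqrt g / 2 powr b \<le> sqrt g * sqrt g powr b / 2 powr b"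
    using g b by (intro divide_right_mono) (auto simp: ge_one_powr_ge_zero)
  also have "\<dots> = (x powr (\<beta> + (\<beta> - 1) * b)) * (sqrt g * sqrt g powr b / 2 powr b)"
    using x by (simp add: id)
  also have "\<dots> = (x powr \<beta> * sqrt g) * (x powr (\<beta> - 1) * sqrt g / 2) powr b"
    using x g by (simp add: powr_add powr_mult powr_divide powr_powr)
  also have "x powr (\<beta> - 1) * sqrt g / 2 = (x powr \<beta> * sqrt g) / (2 * x)"
    using x by (simp add: powr_diff)
  also have "(x powr \<beta> * sqrt g) * ((x powr \<beta> * sqrt g) / (2 * x)) powr b \<le> y * (y / (2 * x)) powr b"
    using x g y b by (intro mult_mono powr_mono2 divide_right_mono) (auto intro: order_trans[OF _ y])
  finally show ?thesis .
qed

text \<open>The powers of \<open>n\<close> cancel by the second exponent identity. Lowering the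
  degree by the factor \<open>g\<close> gains the power 1 / (2 (k - 1)), while raising m by
  \<open>sqrt g\<close> loses only the power 1 / (4 k).\<close>

lemma degree_tail_bound:
  fixes k M n :: nat and g \<alpha> \<beta> :: real
  assumes k: "k \<ge> 2" and n: "n \<ge> 1" and g: "g \<ge> 1"
    and id: "\<alpha> * (1 / (2 * (real k - 1))) + (\<beta> - 1) * (1 / (2 * real k)) = 0"
    and D: "D = real n powr \<alpha> / g" "D \<ge> 1"
    and M: "real M + 1 \<le> c * (real n powr \<beta> * sqrt g)" and c: "c \<ge> 0"
  shows "degree_tail k M n D \<le>
     2 * (4 * real k) powr (1 / (2 * (real k - 1))) * c powr (1 / (2 * real k)) *
       g powr (- (1 / (2 * (real k - 1)) - 1 / (4 * real k)))"
proof -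
  define \<theta> where "\<theta> = 1 / (2 * (real k - 1))"
  define \<gamma> where "\<gamma> = 1 / (2 * real k)"
  have pos: "\<theta> > 0" "\<gamma> > 0" using k by (simp_all add: \<theta>_def \<gamma>_def)
  have x: "real n \<ge> 1" using n by simp
  have 1: "2 * real k * (D + 1) \<le> 4 * real k * (real n powr \<alpha> / g)"
    using mult_left_mono[OF D(2), of "2 * real k"] by (simp add: D(1)[symmetric] algebra_simps)
  have "(real M + 1) / (real n + 1) \<le> c * (real n powr \<beta> * sqrt g) / real n"
    using M x c by (intro frac_le) auto
  also have "\<dots> = c * (real n powr (\<beta> - 1) * sqrt g)" using x by (simp add: powr_diff)
  finally have 2: "(real M + 1) / (real n + 1) \<le> c * (real n powr (\<beta> - 1) * sqrt g)" .
  have "(2 * real k * (D + 1)) powr \<theta> \<le> (4 * real k * (real n powr \<alpha> / g)) powr \<theta>"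
    using pos D(2) by (intro powr_mono2[OF _ _ 1]) auto
  moreover have "((real M + 1) / (real n + 1)) powr \<gamma> \<le> (c * (real n powr (\<beta> - 1) * sqrt g)) powr \<gamma>"
    using pos by (intro powr_mono2[OF _ _ 2]) auto
  ultimately have "degree_tail k M n D \<le>
     2 * (4 * real k * (real n powr \<alpha> / g)) powr \<theta> * (c * (real n powr (\<beta> - 1) * sqrt g)) powr \<gamma>"
    unfolding degree_tail_def \<theta>_def[symmetric] \<gamma>_def[symmetric]
    by (intro mult_mono) auto
  also have "\<dots> = 2 * (4 * real k) powr \<theta> * c powr \<gamma> * (real n powr (\<alpha> * \<theta> + (\<beta> - 1) * \<gamma>)) *
      (sqrt g powr \<gamma> / g powr \<theta>)"
    using c g x by (simp add: powr_mult powr_divide powr_powr powr_add)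
  also have "\<alpha> * \<theta> + (\<beta> - 1) * \<gamma> = 0" using id by (simp add: \<theta>_def \<gamma>_def)
  also have "sqrt g powr \<gamma> / g powr \<theta> = g powr (- (\<theta> - 1 / (4 * real k)))"
    using g by (simp add: powr_half_sqrt[symmetric] powr_powr powr_diff[symmetric] \<gamma>_def)
  finally show ?thesis using x by (simp add: \<theta>_def \<gamma>_def)
qed

text \<open>The source \<open>s n\<close> may depend on the graph. Since \<lceil>T\<rceil> rounds
  are run and the trace includes the initial state, it records every time
  \<open>t < T\<close>.\<close>

theorem theorem2:
  fixes k :: nat and f :: "nat \<Rightarrow> real" and s :: "nat \<Rightarrow> nat set set \<Rightarrow> nat"
  assumes "k \<ge> 2"
    and "f \<in> o(\<lambda>n. ln (ln (real n)))"
    and "filterlim f at_top at_top"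
    and "\<And>n E. s n E < n + k"
  shows "(\<lambda>n. let T = real n powr ((real k - 1) / (real k ^ 2 + real k - 1)) / (f n)\<^sup>2
              in measure_pmf.prob (pp_experiment k n (s n) (nat \<lceil>T\<rceil>))
                   {(E, tr). needs_at_least {..<n + k} T tr})
         \<longlonglongrightarrow> 1"
proof -
  define \<alpha> where "\<alpha> = (real k - 1) / (real k ^ 2 + real k - 1)"
  define \<beta> where "\<beta> = (real k ^ 2 - 1) / (real k ^ 2 + real k - 1)"
  define b where "b = (real k ^ 2 - 1) / real k"
  define C where "C = (real k * (real k + 1)) ^ (k - 1)"
  define \<kappa> where "\<kappa> = 1 / (2 * (real k - 1)) - 1 / (4 * real k)"
  define c where "c = 4 * (real k + 1)"
  define C' where "C' = 2 * (4 * real k) powr (1 / (2 * (real k - 1))) * c powr (1 / (2 * real k))"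
  \<comment> \<open>The factor \<open>sqrt (f n)\<close> above the threshold lets the expected
    number of barriers tend to infinity.\<close>
  define m where "m n = nat \<lceil>real n powr \<beta> * sqrt (f n)\<rceil>" for n
  define R where "R n = real n powr \<alpha> / (f n)\<^sup>2" for n
  define p where "p n = measure_pmf.prob (pp_experiment k n (s n) (nat \<lceil>R n\<rceil>))
                   {(E, tr). needs_at_least {..<n + k} (R n) tr}" for n
  define H where "H y = 4 * (C / (sqrt y / 2 powr b)) + 4 * real k * (C' * y powr (- \<kappa>)) + 4 * (real k)\<^sup>2 / y"
    for y :: real
  define \<rho> where "\<rho> n = (real (m n) / real (m n - k)) ^ (2 * k) - 1" for n
  have k: "real k \<ge> 2" using assms(1) by simp
  note exps = powr_exponent_identities[OF assms(1), folded \<alpha>_def \<beta>_def]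
  have b: "b \<ge> 0" using k by (simp add: b_def)
  have \<kappa>: "\<kappa> > 0" using k by (simp add: \<kappa>_def field_simps)
  have C: "C > 0" using k by (simp add: C_def)

  have ev_f1: "eventually (\<lambda>n. f n \<ge> 1) at_top"
    using assms(3) by (simp add: filterlim_at_top)
  \<comment> \<open>The growth bound on \<open>f\<close> enters as
    \<open>f n \<le> ln (real n)\<close>: then powers of \<open>f\<close> are negligible against
    powers of \<open>n\<close>, which gives \<open>R n \<ge> 1\<close> and room for all windows
    before \<open>n\<close>.\<close>
  have ev_fln: "eventually (\<lambda>n. f n \<le> ln (real n)) at_top"
  proof -
    have "eventually (\<lambda>n. norm (f n) \<le> 1 * norm (ln (ln (real n)))) at_top"
      by (rule landau_o.smallD[OF assms(2)]) simp
    moreover have "eventually (\<lambda>n. \<bar>ln (ln (real n))\<bar> \<le> ln (real n)) at_top" by real_asymp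
    ultimately show ?thesis by eventually_elim auto
  qed
  have ev_R: "eventually (\<lambda>n. R n \<ge> 1) at_top"
  proof -
    have "eventually (\<lambda>n. (ln (real n))\<^sup>2 \<le> real n powr \<alpha>) at_top"
      using exps(1) by real_asymp
    with ev_f1 ev_fln show ?thesis
    proof eventually_elim
      case (elim n)
      have "(f n)\<^sup>2 \<le> (ln (real n))\<^sup>2" using elim by (intro power_mono) auto
      hence "(f n)\<^sup>2 \<le> real n powr \<alpha>" using elim(3) by (rule order_trans)
      thus "R n \<ge> 1" using elim by (simp add: R_def)
    qed
  qed
  have m_le: "real (m n) \<le> 2 * (real n powr \<beta> * sqrt (f n))" if "n \<ge> 1" "f n \<ge> 1" for n
  proof -
    have "real n powr \<beta> * sqrt (f n) \<ge> 1 * 1"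
      using that exps(2) by (intro mult_mono ge_one_powr_ge_zero) auto
    thus ?thesis unfolding m_def by linarith
  qed
  have m_ge: "real (m n) \<ge> real n powr \<beta> * sqrt (f n)" for n
    unfolding m_def by linarith
  have ev_M: "eventually (\<lambda>n. Suc k * m n \<le> n) at_top"
  proof -
    have "eventually (\<lambda>n. (real k + 1) * (2 * (real n powr \<beta> * sqrt (ln (real n)))) \<le> real n) at_top"
      using exps(2,3) k by real_asymp
    with ev_f1 ev_fln eventually_ge_at_top[of 1] show ?thesis
    proof eventually_elim
      case (elim n)
      have "real (Suc k * m n) = (real k + 1) * real (m n)" by (simp add: algebra_simps)
      also have "\<dots> \<le> (real k + 1) * (2 * (real n powr \<beta> * sqrt (f n)))"
        using m_le[of n] elim by (intro mult_left_mono) auto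
      also have "\<dots> \<le> (real k + 1) * (2 * (real n powr \<beta> * sqrt (ln (real n))))"
        using elim by (intro mult_left_mono) auto
      also have "\<dots> \<le> real n" by fact
      finally show ?case by (simp only: of_nat_le_iff)
    qed
  qed
  have m_top: "filterlim (\<lambda>n. real (m n)) at_top at_top"
  proof (rule filterlim_at_top_mono)
    show "filterlim (\<lambda>n. sqrt (f n)) at_top at_top"
      by (rule filterlim_compose[OF sqrt_at_top assms(3)])
    show "eventually (\<lambda>n. sqrt (f n) \<le> real (m n)) at_top"
      using ev_f1 eventually_ge_at_top[of 1]
    proof eventually_elim
      case (elim n)
      have "1 * sqrt (f n) \<le> real n powr \<beta> * sqrt (f n)"
        using elim exps(2) by (intro mult_right_mono ge_one_powr_ge_zero) auto
      with m_ge[of n] show ?case by simp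
    qed
  qed
  hence ev_m: "eventually (\<lambda>n. m n \<ge> 2 * k + 2) at_top"
    unfolding filterlim_at_top
    by (drule_tac x = "real (2 * k + 2)" in spec) (simp only: of_nat_le_iff)

  have lower: "eventually (\<lambda>n. 1 - (H (f n) + 4 * \<rho> n) \<le> p n) at_top"
    using ev_f1 ev_R ev_M ev_m eventually_ge_at_top[of 1]
  proof eventually_elim
    case (elim n)
    \<comment> \<open>One factor \<open>f n\<close> makes the degree tail vanish. The other one, in
      D = R f, makes about \<open>R n\<close> rounds too few to cross the cut.\<close>
    define D where "D = real n powr \<alpha> / f n"
    define M where "M = Suc k * m n"
    have DR: "D = R n * f n" using elim by (simp add: D_def R_def power2_eq_square)
    have D1: "D \<ge> 1" using mult_mono[of 1 "R n" 1 "f n"] elim by (simp add: DR)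
    have "1 - (4 * (C / (real (m n) * (real (m n) / (2 * real n)) powr b) + \<rho> n)
         + 4 * real k * degree_tail k M n D + real (nat \<lceil>R n\<rceil>) * (2 * (real k)\<^sup>2 / D)) \<le> p n"
      using prob_slow[OF assms(1), where m = "m n" and M = M and n = n and D = D and s = "s n"
          and T = "nat \<lceil>R n\<rceil>" and R = "R n"] assms(4) elim D1
      by (simp add: p_def C_def b_def \<rho>_def M_def)
    moreover have "C / (real (m n) * (real (m n) / (2 * real n)) powr b) \<le> C / (sqrt (f n) / 2 powr b)"
      using barrier_count_bound[of "f n" "real n" b \<beta> "real (m n)"] elim b exps(4) m_ge C
      by (intro frac_le) (auto simp: b_def)
    moreover have "degree_tail k M n D \<le> C' * f n powr (- \<kappa>)"
      unfolding C'_def \<kappa>_def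
    proof (rule degree_tail_bound[OF assms(1) _ _ exps(5)])
      have "M \<ge> 1" using elim by (simp add: M_def)
      hence "real M + 1 \<le> 2 * real M" by simp
      also have "\<dots> = 2 * ((real k + 1) * real (m n))" by (simp add: M_def algebra_simps)
      also have "\<dots> \<le> 2 * ((real k + 1) * (2 * (real n powr \<beta> * sqrt (f n))))"
        using m_le[of n] elim by (intro mult_left_mono) auto
      finally show "real M + 1 \<le> c * (real n powr \<beta> * sqrt (f n))" by (simp add: c_def algebra_simps)
    qed (use elim D1 in \<open>auto simp: D_def c_def\<close>)
    hence "4 * real k * degree_tail k M n D \<le> 4 * real k * (C' * f n powr (- \<kappa>))"
      by (rule mult_left_mono) simp
    moreover have "real (nat \<lceil>R n\<rceil>) * (2 * (real k)\<^sup>2 / D) \<le> 4 * (real k)\<^sup>2 / f n"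
    proof -
      \<comment> \<open>Rounding up at most doubles a number that is at least 1.\<close>
      have "real (nat \<lceil>R n\<rceil>) \<le> 2 * R n" using elim by linarith
      hence "real (nat \<lceil>R n\<rceil>) * (2 * (real k)\<^sup>2 / D) \<le> (2 * R n) * (2 * (real k)\<^sup>2 / D)"
        using D1 by (intro mult_right_mono) auto
      also have "\<dots> = 4 * (real k)\<^sup>2 / f n" using elim by (simp add: DR)
      finally show ?thesis .
    qed
    ultimately show ?case unfolding H_def by argo
  qed
  have "(H \<longlongrightarrow> 0) at_top"
  proof -
    have "((\<lambda>y::real. 1 / sqrt y) \<longlongrightarrow> 0) at_top" "((\<lambda>y::real. 1 / y) \<longlongrightarrow> 0) at_top"
      by real_asymp+
    moreover have "((\<lambda>y::real. y powr (- \<kappa>)) \<longlongrightarrow> 0) at_top"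
      using \<kappa> by real_asymp
    ultimately have "((\<lambda>y. 4 * C * 2 powr b * (1 / sqrt y) + 4 * real k * C' * y powr (- \<kappa>) + 4 * (real k)\<^sup>2 * (1 / y))
        \<longlongrightarrow> 4 * C * 2 powr b * 0 + 4 * real k * C' * 0 + 4 * (real k)\<^sup>2 * 0) at_top"
      by (intro tendsto_intros)
    thus ?thesis unfolding H_def by (simp add: mult_ac)
  qed
  hence "(\<lambda>n. H (f n)) \<longlonglongrightarrow> 0" by (rule filterlim_compose) (rule assms(3))
  moreover have "\<rho> \<longlonglongrightarrow> 0"
  proof -
    have "((\<lambda>y. (y / (y - real k)) ^ (2 * k) - 1) \<longlongrightarrow> 1 ^ (2 * k) - 1) at_top"
      by (intro tendsto_intros) real_asymp
    hence "((\<lambda>n. (real (m n) / (real (m n) - real k)) ^ (2 * k) - 1) \<longlongrightarrow> 1 ^ (2 * k) - 1) at_top"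
      by (rule filterlim_compose) (rule m_top)
    moreover have "eventually (\<lambda>n. (real (m n) / (real (m n) - real k)) ^ (2 * k) - 1 = \<rho> n) at_top"
      using ev_m by eventually_elim (simp add: \<rho>_def of_nat_diff)
    ultimately show ?thesis by (simp add: tendsto_cong)
  qed
  ultimately have "(\<lambda>n. 1 - (H (f n) + 4 * \<rho> n)) \<longlonglongrightarrow> 1 - (0 + 4 * 0)"
    by (intro tendsto_intros)
  hence "p \<longlonglongrightarrow> 1"
    by (intro tendsto_sandwich[OF lower _ _ tendsto_const]) (auto simp: p_def)
  thus ?thesis unfolding p_def[abs_def] R_def \<alpha>_def Let_def .
qed

end
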